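(* Assume (A1.1), (A1.2), (A1.3), and assume that (A2) and (A3) (stated in the context) hold for $P(\cdot,\beta_k)$ for all $k\ge 1$, where $(\beta_k)_k$ are the penalty parameters produced by the mean-field penalized CBO algorithm described in the context. Let $f$ be constructed by that algorithm with initial datum $f_0\in\mathcal P_4(\mathbb R^d)$ such that $$\{x^*_{\beta_k}\in\mathbb R^d : \beta_k<\bar\beta\}\cup\{x^*\}\subseteq \operatorname{supp}(f_0),$$ where $x^*_\beta=\operatorname{argmin}_{x\in\mathbb R^d}P(x,\beta)$ and $x^*$ is the solution of the constrained problem $\min_{x\in\mathcal M} j(x)$. Let $$\mathcal V(t)=\frac12\int\|x-x^*\|^2\,df(t,x).$$ Given an accuracy $\varepsilon\in(0,\mathcal V(0))$, if $K$, $\theta_0$ and $\alpha$ are large enough, then there exists $T^*\in[0,K\Delta t]$ such that $\mathcal V(T^* )=\varepsilon$.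
   Context: Problem. $j:\mathbb R^d\to\mathbb R$ is continuous, $\mathcal M\subset\mathbb R^d$ has boundary of zero Lebesgue measure, and $x^*$ denotes the global solution of $\min_{x\in\mathcal M}j(x)$. For $\beta\ge 0$ let $P(x,\beta)=j(x)+\beta r(x)$, where $r=0$ on $\mathcal M$ and $r>0$ outside $\mathcal M$. $x^*_\beta$ denotes the minimizer of $P(\cdot,\beta)$ over $\mathbb R^d$. $\|\cdot\|$ is the Euclidean norm. Assumptions. (A1.1) There is $\bar\beta\ge0$ such that for all $\beta\ge\bar\beta$ the minimizer of $P(\cdot,\beta)$ over $\mathbb R^d$ is the global solution $x^*$ of the constrained problem. (A1.2) For $\beta<\bar\beta$, $\inf_{x\in\mathbb R^d}P(x,\beta)<\inf_{x\in\mathcal M}j(x)$. (A1.3) $r(x)=\operatorname{dist}(x,\mathcal M)=\min_{y\in\mathcal M}\|x-y\|$ (the minimum being attained). (A2) for $P(\cdot,\beta)$: for some $p\ge2$ and constants $C_1',R_1'>0$, $P(x,\beta)-\inf_{\mathbb R^d}P(\cdot,\beta)\ge C_1'\|x-x^*_\beta\|^p$ for all $x$ with $\|x-x^*_\beta\|^2\le R_1'$. (A3) for $P(\cdot,\beta)$: with the same $R_1'$, there is $P^\infty_\beta>0$ such that $P(x,\beta)-\inf_{\mathbb R^d}P(\cdot,\beta)\ge P^\infty_\beta$ for all $x$ with $\|x-x^*_\beta\|^2\ge R_1'$. $\mathcal P_4(\mathbb R^d)$ is the set of Borel probability measures with finite fourth moment. Fokker–Planck equation with penalty parameter $\beta$: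 $$\partial_t f=\lambda\,\mathrm{div}\big((x-x_\alpha(f))f\big)+\frac{\sigma^2}{2}\Delta\big(\|x-x_\alpha(f)\|^2 f\big),\qquad x_\alpha(f)=\frac{\int x\,e^{-\alpha P(x,\beta)}\,df(t,x)}{\int e^{-\alpha P(x,\beta)}\,df(t,x)} .$$ A solution on a time interval $[a,b]$ with initial datum $\mu\in\mathcal P_4(\mathbb R^d)$ is a weak solution $f\in\mathcal C([a,b],\mathcal P_4(\mathbb R^d))$, i.e. $\lim_{t\to a}f(t)=\mu$ and, for all $t\in(a,b)$ and all $\phi\in\mathcal C^2_*(\mathbb R^d)$, $$\frac{d}{dt}\int\phi\,df(t,x)=-\lambda\int(x-x_\alpha(f))\cdot\nabla\phi(x)\,df(t,x)+\frac{\sigma^2}{2}\int\|x-x_\alpha(f)\|^2\Delta\phi(x)\,df(t,x),$$ where $\mathcal C^2_*(\mathbb R^d)=\{\phi\in\mathcal C^2(\mathbb R^d):\|\nabla\phi(x)\|\le C(1+\|x\|)\text{ for some }C,\ \sup_x|\Delta\phi(x)|<\infty\}$. Mean-field penalized CBO algorithm. Parameters: $\alpha>0$, $\lambda,\sigma>0$ with $2\lambda>d\sigma^2$; $\beta_0>0$, $\theta_0>0$, $\eta_\theta>1$, $\eta_\beta>1$, $\Delta t>0$, $K\in\mathbb N$; initial datum $f_0$. Set $t_k=k\Delta t$, $\beta_1=\beta_0$, $\theta_1=\theta_0$. For $k=1,\dots,K$: let $f$ on $[t_{k-1},t_k]$ be the solution of the Fokker–Planck equation with penalty parameter $\beta_k$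 and initial datum $f_{k-1}$ at time $t_{k-1}$; set $f_k=f(t_k)$; if the feasibility condition $\int r(x)\,df_k(x)\le 1/\sqrt{\theta_k}$ holds, set $\theta_{k+1}=\eta_\theta\theta_k$, $\beta_{k+1}=\beta_k$; otherwise set $\theta_{k+1}=\min\{\theta_k/\eta_\theta,\theta_0\}$, $\beta_{k+1}=\eta_\beta\beta_k$. Convention: "$K,\theta_0,\alpha$ large enough" means that there are thresholds, depending on $\varepsilon$ and on the remaining data, such that the conclusion holds whenever $K,\theta_0,\alpha$ exceed them. *)

theory Defs
  imports "HOL-Probability.Probability"
begin

definition P4 :: "'a::euclidean_space measure set" where
  "P4 = {\<mu>. prob_space \<mu> \<and> sets \<mu> = sets borel \<and> integrable \<mu> (\<lambda>x. norm x ^ 4)}"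

definition couplings ::
  "'a::euclidean_space measure \<Rightarrow> 'a measure \<Rightarrow> ('a \<times> 'a) measure set" where
  "couplings \<mu> \<nu> = {\<pi>. sets \<pi> = sets (borel \<Otimes>\<^sub>M borel) \<and>
     distr \<pi> borel fst = \<mu> \<and> distr \<pi> borel snd = \<nu>}"

text \<open>The metric of \<^const>\<open>P4\<close> is the Wasserstein distance of order 4. It is only meant for
  arguments in \<^const>\<open>P4\<close>, where the cost is integrable with respect to every coupling.\<close>

definition W4 :: "'a::euclidean_space measure \<Rightarrow> 'a measure \<Rightarrow> real" where
  "W4 \<mu> \<nu> = root 4 (INF \<pi>\<in>couplings \<mu> \<nu>. LINT z|\<pi>. norm (fst z - snd z) ^ 4)"

definition P4_continuous_on :: "real set \<Rightarrow> (real \<Rightarrow> 'a::euclidean_space measure) \<Rightarrow> bool" where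
  "P4_continuous_on S f \<longleftrightarrow>
     (\<forall>t\<in>S. f t \<in> P4 \<and> ((\<lambda>s. W4 (f s) (f t)) \<longlongrightarrow> 0) (at t within S))"

definition supp :: "'a::euclidean_space measure \<Rightarrow> 'a set" where
  "supp \<mu> = {x. \<forall>U. open U \<and> x \<in> U \<longrightarrow> emeasure \<mu> U > 0}"

definition gradient :: "('a::euclidean_space \<Rightarrow> real) \<Rightarrow> 'a \<Rightarrow> 'a" where
  "gradient \<phi> x = (THE g. GDERIV \<phi> x :> g)"

definition laplacian :: "('a::euclidean_space \<Rightarrow> real) \<Rightarrow> 'a \<Rightarrow> real" where
  "laplacian \<phi> x = (\<Sum>b\<in>Basis. frechet_derivative (gradient \<phi>) (at x) b \<bullet> b)"

definition C2 :: "('a::euclidean_space \<Rightarrow> real) set" where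
  "C2 = {\<phi>. (\<forall>x. \<phi> differentiable at x) \<and> (\<forall>x. gradient \<phi> differentiable at x) \<and>
     (\<forall>b\<in>Basis. continuous_on UNIV (\<lambda>x. frechet_derivative (gradient \<phi>) (at x) b))}"

definition C2_star :: "('a::euclidean_space \<Rightarrow> real) set" where
  "C2_star = {\<phi>\<in>C2. (\<exists>C. \<forall>x. norm (gradient \<phi> x) \<le> C * (1 + norm x)) \<and>
     bounded (range (laplacian \<phi>))}"

definition penalized ::
  "('a::euclidean_space \<Rightarrow> real) \<Rightarrow> ('a \<Rightarrow> real) \<Rightarrow> real \<Rightarrow> 'a \<Rightarrow> real" where
  "penalized j r \<beta> x = j x + \<beta> * r x"

definition argmin_penalized ::
  "('a::euclidean_space \<Rightarrow> real) \<Rightarrow> ('a \<Rightarrow> real) \<Rightarrow> real \<Rightarrow> 'a" where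
  "argmin_penalized j r \<beta> = arg_min (penalized j r \<beta>) (\<lambda>_. True)"

text \<open>Conditions (A2) and (A3) for an objective \<open>F\<close> with minimizer \<open>z\<close>. The infimum is the real one,
  which is the intended one because both are used with \<open>F\<close> attaining its minimum at \<open>z\<close>.\<close>

definition growth_near ::
  "('a::euclidean_space \<Rightarrow> real) \<Rightarrow> 'a \<Rightarrow> real \<Rightarrow> real \<Rightarrow> real \<Rightarrow> bool" where
  "growth_near F z p C R \<longleftrightarrow>
     (\<forall>x. (norm (x - z))\<^sup>2 \<le> R \<longrightarrow> F x - (INF y. F y) \<ge> C * norm (x - z) powr p)"

definition gap_away :: "('a::euclidean_space \<Rightarrow> real) \<Rightarrow> 'a \<Rightarrow> real \<Rightarrow> bool" where
  "gap_away F z R \<longleftrightarrow>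
     (\<exists>G>0. \<forall>x. (norm (x - z))\<^sup>2 \<ge> R \<longrightarrow> F x - (INF y. F y) \<ge> G)"

definition A2_A3 :: "('a::euclidean_space \<Rightarrow> real) \<Rightarrow> ('a \<Rightarrow> real) \<Rightarrow> real \<Rightarrow> bool" where
  "A2_A3 j r \<beta> \<longleftrightarrow>
     is_arg_min (penalized j r \<beta>) (\<lambda>_. True) (argmin_penalized j r \<beta>) \<and>
     (\<exists>p\<ge>2. \<exists>C>0. \<exists>R>0.
        growth_near (penalized j r \<beta>) (argmin_penalized j r \<beta>) p C R \<and>
        gap_away (penalized j r \<beta>) (argmin_penalized j r \<beta>) R)"

definition consensus_point ::
  "real \<Rightarrow> ('a::euclidean_space \<Rightarrow> real) \<Rightarrow> 'a measure \<Rightarrow> 'a" where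
  "consensus_point \<alpha> F \<mu> =
     (LINT x|\<mu>. exp (- \<alpha> * F x) *\<^sub>R x) /\<^sub>R (LINT x|\<mu>. exp (- \<alpha> * F x))"

definition FP_solution ::
  "real \<Rightarrow> real \<Rightarrow> real \<Rightarrow> ('a::euclidean_space \<Rightarrow> real) \<Rightarrow> real \<Rightarrow> real \<Rightarrow> 'a measure
    \<Rightarrow> (real \<Rightarrow> 'a measure) \<Rightarrow> bool" where
  "FP_solution lam \<sigma> \<alpha> F a b \<mu> f \<longleftrightarrow>
     P4_continuous_on {a..b} f \<and>
     ((\<lambda>t. W4 (f t) \<mu>) \<longlongrightarrow> 0) (at a within {a..b}) \<and>
     (\<forall>t\<in>{a<..<b}. \<forall>\<phi>\<in>C2_star.
        ((\<lambda>s. LINT x|f s. \<phi> x) has_real_derivative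
          (- lam * (LINT x|f t. (x - consensus_point \<alpha> F (f t)) \<bullet> gradient \<phi> x)
           + \<sigma>\<^sup>2 / 2 * (LINT x|f t. (norm (x - consensus_point \<alpha> F (f t)))\<^sup>2 * laplacian \<phi> x)))
        (at t))"

text \<open>A single curve \<open>f\<close> on \<open>[0, K * dt]\<close> carries all the pieces: the iterate with index \<open>k\<close> is
  \<open>f (k * dt)\<close>. The sequences \<open>\<beta>\<close> and \<open>\<theta>\<close> are relevant at the indices \<open>1, \<dots>, K + 1\<close> only.\<close>

definition penalized_CBO ::
  "('a::euclidean_space \<Rightarrow> real) \<Rightarrow> ('a \<Rightarrow> real) \<Rightarrow> real \<Rightarrow> real \<Rightarrow> real \<Rightarrow> real \<Rightarrow> real \<Rightarrow> real \<Rightarrow> real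
    \<Rightarrow> real \<Rightarrow> nat \<Rightarrow> 'a measure \<Rightarrow> (real \<Rightarrow> 'a measure) \<Rightarrow> (nat \<Rightarrow> real) \<Rightarrow> (nat \<Rightarrow> real) \<Rightarrow> bool" where
  "penalized_CBO j r lam \<sigma> \<alpha> \<beta>0 \<theta>0 \<eta>\<theta> \<eta>\<beta> dt K f0 f \<beta> \<theta> \<longleftrightarrow>
     f 0 = f0 \<and> \<beta> 1 = \<beta>0 \<and> \<theta> 1 = \<theta>0 \<and>
     (\<forall>k\<in>{1..K}.
        FP_solution lam \<sigma> \<alpha> (penalized j r (\<beta> k)) (real (k - 1) * dt) (real k * dt)
          (f (real (k - 1) * dt)) f \<and>
        (if (LINT x|f (real k * dt). r x) \<le> 1 / sqrt (\<theta> k)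
         then \<theta> (k + 1) = \<eta>\<theta> * \<theta> k \<and> \<beta> (k + 1) = \<beta> k
         else \<theta> (k + 1) = min (\<theta> k / \<eta>\<theta>) \<theta>0 \<and> \<beta> (k + 1) = \<eta>\<beta> * \<beta> k))"

definition half_msd :: "'a::euclidean_space \<Rightarrow> 'a measure \<Rightarrow> real" where
  "half_msd z \<mu> = 1 / 2 * (LINT x|\<mu>. (norm (x - z))\<^sup>2)"

end

theory Submission
  imports Defs
begin

text \<open>
  Write \<open>V t\<close> for \<^term>\<open>half_msd xstar (f t)\<close>, \<open>z\<close> for the minimizer of the penalized objective that is
  in force, and \<open>X\<close> for the consensus point. If \<open>V\<close> never took the value \<open>\<epsilon>\<close> it would stay above
  \<open>\<epsilon>\<close> by the intermediate value theorem. The proof shows that, for suitable thresholds, \<open>V\<close> would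
  then become negative after a number \<open>N\<close> of steps that depends on the data and \<open>\<epsilon>\<close> only. Since only
  the first \<open>N\<close> steps matter, finitely many penalty parameters \<open>\<beta>0 * \<eta>\<beta> ^ i\<close> occur, and maxima over
  them give the thresholds for \<open>\<theta>0\<close> and \<open>\<alpha>\<close>.

  Two differential inequalities control the flow. Testing the equation with half the squared distance
  to any point \<open>z\<close> gives \<open>U' \<le> - \<kappa> * U + D * norm (X - z)^2\<close> with \<open>\<kappa> = (2 * lam - d * \<sigma>^2) / 2 > 0\<close>
  (\<open>generator_half_sq_dist_le\<close>). Testing it with the bump \<open>(\<rho>^2 - norm (x - z)^2)^3\<close>, cut off at \<open>0\<close>,
  gives \<open>\<Phi>' \<ge> - q * \<Phi>\<close> as long as \<open>X\<close> stays in a fixed ball around \<open>z\<close> (\<open>generator_bump_ge\<close>):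
  noise pushes mass in near the rim of the bump faster than the drift can carry it out. So mass that
  lies near \<open>z\<close> at time \<open>0\<close>, because \<open>z\<close> is in the support of \<open>f0\<close>, is never lost completely.

  The quantitative Laplace principle (\<open>laplace_principle\<close>) closes the loop: if at least \<open>c\<close> of bump
  mass is near \<open>z\<close> and the second moment is at most \<open>u\<close>, then \<open>X\<close> is within \<open>\<eta>\<close> of \<open>z\<close> for all large
  \<open>\<alpha>\<close>, and how large depends on the measure through \<open>c\<close> and \<open>u\<close> only. While \<open>X\<close> is within \<open>\<eta>\<close> of
  \<open>z\<close>, the two inequalities keep the mass strictly above \<open>c\<close> and the moment strictly below \<open>u\<close>; by
  continuity \<open>X\<close> stays within \<open>\<eta>\<close> of \<open>z\<close> during the whole step (\<open>consensus_point_stays_near\<close>).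

  The steps now fall into two phases. As long as \<open>\<beta> < \<beta>bar\<close>, the minimizer \<open>z\<close> is infeasible, the
  retained mass near \<open>z\<close> bounds the average of \<open>r\<close> from below, and for large \<open>\<theta>0\<close> every feasibility
  test fails. Hence \<open>\<beta>\<close> is multiplied by \<open>\<eta>\<beta>\<close> each time and reaches \<open>\<beta>bar\<close> after a fixed number of
  steps; meanwhile \<open>V\<close> grows at most linearly. From then on \<open>z = xstar\<close>, and \<open>V\<close> decreases at rate at
  least \<open>\<kappa> * \<epsilon> / 2\<close> while it is above \<open>\<epsilon>\<close>, whatever the outcome of the feasibility tests.
\<close>

section \<open>Test functions\<close>

lemma gradient_eqI:
  assumes "GDERIV \<phi> x :> g"
  shows "gradient \<phi> x = g"
  unfolding gradient_def
proof (rule the_equality)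
  fix h assume "GDERIV \<phi> x :> h"
  then have "(\<lambda>k. k \<bullet> h) = (\<lambda>k. k \<bullet> g)"
    using assms unfolding gderiv_def by (rule has_derivative_unique)
  then have "(h - g) \<bullet> h = (h - g) \<bullet> g" by metis
  then have "(h - g) \<bullet> (h - g) = 0" by (simp add: inner_diff_right)
  then show "h = g" by simp
qed (rule assms)

text \<open>The definite description in the gradient and the canonical derivative behind the Laplacian are
  resolved once here, from explicit candidates \<open>g\<close> and \<open>H\<close>.\<close>
lemma C2_starI:
  fixes \<phi> :: "'a::euclidean_space \<Rightarrow> real"
  assumes grad: "\<And>x. GDERIV \<phi> x :> g x"
    and hess: "\<And>x. (g has_derivative H x) (at x)"
    and cont: "\<And>b. b \<in> Basis \<Longrightarrow> continuous_on UNIV (\<lambda>x. H x b)"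
    and growth: "\<And>x. norm (g x) \<le> C * (1 + norm x)"
    and lap: "\<And>x. \<bar>\<Sum>b\<in>Basis. H x b \<bullet> b\<bar> \<le> L"
  shows "\<phi> \<in> C2_star" and "gradient \<phi> = g" and "laplacian \<phi> = (\<lambda>x. \<Sum>b\<in>Basis. H x b \<bullet> b)"
proof -
  show g: "gradient \<phi> = g" using gradient_eqI[OF grad] by blast
  have H: "frechet_derivative g (at x) = H x" for x
    using frechet_derivative_at[OF hess] by simp
  show lap_eq: "laplacian \<phi> = (\<lambda>x. \<Sum>b\<in>Basis. H x b \<bullet> b)"
    unfolding laplacian_def g H ..
  have "\<phi> differentiable at x" "g differentiable at x" for x
    using grad hess unfolding gderiv_def differentiable_def by blast+
  then have "\<phi> \<in> C2" using cont by (simp add: C2_def g H)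
  moreover have "bounded (range (laplacian \<phi>))"
    unfolding lap_eq using lap by (auto intro!: boundedI[where B = L])
  ultimately show "\<phi> \<in> C2_star" using growth by (auto simp: C2_star_def g)
qed

text \<open>The gradient bound integrated along the segment from \<open>x\<close> to \<open>y\<close>. This modulus is what makes
  integrals of test functions continuous for the Wasserstein distance.\<close>
lemma C2_star_lipschitz:
  assumes "\<phi> \<in> C2_star"
  obtains C where "C \<ge> 0"
    and "\<And>x y. \<bar>\<phi> x - \<phi> y\<bar> \<le> C * (1 + norm x + norm y) * norm (x - y)"
proof -
  obtain C where C: "\<And>x. norm (gradient \<phi> x) \<le> C * (1 + norm x)"
    and diff: "\<And>x. \<phi> differentiable at x"
    using assms by (auto simp: C2_star_def C2_def)
  have "0 \<le> C * (1 + norm (0::'a))" using C[of 0] norm_ge_zero order_trans by blast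
  then have C0: "C \<ge> 0" by simp
  have "GDERIV \<phi> x :> gradient \<phi> x" for x
  proof -
    obtain D where D: "(\<phi> has_derivative D) (at x)" using diff by (auto simp: differentiable_def)
    interpret bounded_linear D using D by (rule has_derivative_bounded_linear)
    have "D h = h \<bullet> (\<Sum>b\<in>Basis. D b *\<^sub>R b)" for h
    proof -
      have "D h = D (\<Sum>b\<in>Basis. (h \<bullet> b) *\<^sub>R b)" by (simp add: euclidean_representation)
      also have "\<dots> = (\<Sum>b\<in>Basis. (h \<bullet> b) * D b)" by (simp add: sum scaleR)
      finally show ?thesis by (simp add: inner_sum_right mult.commute)
    qed
    then have "D = (\<lambda>h. h \<bullet> (\<Sum>b\<in>Basis. D b *\<^sub>R b))" by (rule ext)
    then have "GDERIV \<phi> x :> (\<Sum>b\<in>Basis. D b *\<^sub>R b)" using D unfolding gderiv_def by metis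
    then show ?thesis using gradient_eqI by metis
  qed
  then have der: "(\<phi> has_derivative (\<lambda>h. h \<bullet> gradient \<phi> x)) (at x)" for x
    by (simp add: gderiv_def)
  have "\<bar>\<phi> x - \<phi> y\<bar> \<le> C * (1 + norm x + norm y) * norm (x - y)" for x y
  proof -
    have "norm (\<phi> x - \<phi> y) \<le> C * (1 + norm x + norm y) * norm (x - y)"
      \<comment> \<open>A convex set containing both end points, on which the gradient bound is uniform.\<close>
    proof (rule differentiable_bound[of "cball 0 (norm x + norm y)"])
      fix u :: 'a assume "u \<in> cball 0 (norm x + norm y)"
      then have "norm u \<le> norm x + norm y" by simp
      then have "C * (1 + norm u) \<le> C * (1 + norm x + norm y)"
        using C0 by (intro mult_left_mono) auto
      with C[of u] have K: "norm (gradient \<phi> u) \<le> C * (1 + norm x + norm y)" by linarith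
      have "norm (h \<bullet> gradient \<phi> u) \<le> C * (1 + norm x + norm y) * norm h" for h
        using Cauchy_Schwarz_ineq2[of h "gradient \<phi> u"] mult_left_mono[OF K norm_ge_zero[of h]]
        by (simp add: mult.commute)
      then show "onorm (\<lambda>h. h \<bullet> gradient \<phi> u) \<le> C * (1 + norm x + norm y)"
        by (rule onorm_le)
    qed (auto intro: der has_derivative_at_withinI)
    then show ?thesis by simp
  qed
  with C0 show ?thesis by (rule that)
qed

lemma norm_diff_le_affine:
  fixes x X :: "'a::real_normed_vector"
  shows "norm (x - X) \<le> (1 + norm X) * (1 + norm x)"
proof -
  have "norm (x - X) \<le> norm x + norm X" by (rule norm_triangle_ineq4)
  also have "\<dots> \<le> (1 + norm X) * (1 + norm x)" by (simp add: algebra_simps)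
  finally show ?thesis .
qed

lemma half_sq_dist_C2_star:
  fixes z :: "'a::euclidean_space"
  defines "\<phi> \<equiv> \<lambda>x. (norm (x - z))\<^sup>2 / 2"
  shows "\<phi> \<in> C2_star" and "gradient \<phi> = (\<lambda>x. x - z)" and "laplacian \<phi> = (\<lambda>x. real DIM('a))"
proof -
  have g: "GDERIV \<phi> x :> x - z" for x
    unfolding gderiv_def \<phi>_def power2_norm_eq_inner
    by (auto intro!: derivative_eq_intros simp: inner_commute)
  have h: "((\<lambda>x. x - z) has_derivative (\<lambda>h. h)) (at x)" for x
    by (auto intro!: derivative_eq_intros)
  have s: "(\<Sum>b\<in>Basis. b \<bullet> (b::'a)) = real DIM('a)"
    by (simp add: inner_Basis)
  note * = C2_starI[OF g h _ norm_diff_le_affine, where L = "real DIM('a)", unfolded s, simplified]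
  show "\<phi> \<in> C2_star" by (rule *(1))
  show "gradient \<phi> = (\<lambda>x. x - z)" by (rule *(2))
  show "laplacian \<phi> = (\<lambda>x. real DIM('a))" by (rule *(3))
qed

text \<open>A test function with compact support that detects mass near \<open>z\<close>. The cube is the lowest integer
  power of the positive part that is twice continuously differentiable.\<close>
definition bump :: "'a::euclidean_space \<Rightarrow> real \<Rightarrow> 'a \<Rightarrow> real" where
  "bump z \<rho> x = (max 0 (\<rho>\<^sup>2 - (norm (x - z))\<^sup>2)) ^ 3"

lemma has_real_derivative_pos_part_power:
  fixes s :: real
  assumes "n \<ge> 2"
  shows "((\<lambda>s. (max 0 s) ^ n) has_real_derivative real n * (max 0 s) ^ (n - 1)) (at s)"
proof (cases s "0::real" rule: linorder_cases)
  case less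
  have "((\<lambda>s. 0) has_real_derivative 0) (at s)" by simp
  then have "((\<lambda>s. (max 0 s) ^ n) has_real_derivative 0) (at s)"
  proof (rule has_field_derivative_transform_within_open[of _ _ _ "{..<0}"])
    show "0 = max 0 t ^ n" if "t \<in> {..<0}" for t :: real
      using that assms by simp
  qed (use less in auto)
  moreover have "real n * (max 0 s) ^ (n - 1) = 0" using less assms by simp
  ultimately show ?thesis by metis
next
  case greater
  have "((\<lambda>s. s ^ n) has_real_derivative real n * s ^ (n - 1)) (at s)"
    by (auto intro!: derivative_eq_intros)
  then have "((\<lambda>s. (max 0 s) ^ n) has_real_derivative real n * s ^ (n - 1)) (at s)"
    by (rule has_field_derivative_transform_within_open[of _ _ _ "{0<..}"]) (use greater in auto)
  then show ?thesis using greater by simp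
next
  case equal
  have "(\<lambda>h. ((max 0 (0 + h)) ^ n - (max 0 0) ^ n) / h) \<midarrow>0\<rightarrow> (0::real)"
  proof (rule tendsto_norm_zero_cancel, rule tendsto_sandwich[of "\<lambda>_. 0" _ _ "\<lambda>h. \<bar>h\<bar> ^ (n - 1)"])
    have "norm (((max 0 (0 + h)) ^ n - (max 0 0) ^ n) / h) \<le> \<bar>h\<bar> ^ (n - 1)" for h :: real
    proof (cases "h > 0")
      case True
      then have "h ^ n = h * h ^ (n - 1)" using assms by (cases n) auto
      then show ?thesis using True assms by (simp add: power_0_left)
    qed (use assms in simp)
    then show "\<forall>\<^sub>F h in at 0. norm (((max 0 (0 + h)) ^ n - (max 0 (0::real)) ^ n) / h) \<le> \<bar>h\<bar> ^ (n - 1)"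
      by simp
    have "(\<lambda>h::real. \<bar>h\<bar> ^ (n - 1)) \<midarrow>0\<rightarrow> \<bar>0\<bar> ^ (n - 1)" by (intro tendsto_intros)
    moreover have "\<bar>0::real\<bar> ^ (n - 1) = 0" using assms by simp
    ultimately show "(\<lambda>h::real. \<bar>h\<bar> ^ (n - 1)) \<midarrow>0\<rightarrow> 0" by metis
  qed auto
  moreover have "real n * (max 0 0) ^ (n - 1) = 0" using assms by simp
  ultimately show ?thesis unfolding equal DERIV_def by metis
qed

lemma bump_C2_star:
  fixes z :: "'a::euclidean_space" and \<rho> :: real
  assumes "\<rho> > 0"
  defines "s \<equiv> \<lambda>x. max 0 (\<rho>\<^sup>2 - (norm (x - z))\<^sup>2)"
  shows "bump z \<rho> \<in> C2_star"
    and "gradient (bump z \<rho>) = (\<lambda>x. (- 6 * (s x)\<^sup>2) *\<^sub>R (x - z))"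
    and "laplacian (bump z \<rho>) =
           (\<lambda>x. 24 * s x * (norm (x - z))\<^sup>2 - 6 * real DIM('a) * (s x)\<^sup>2)"
proof -
  define w where "w = (\<lambda>x::'a. \<rho>\<^sup>2 - (norm (x - z))\<^sup>2)"
  have w: "(w has_derivative (\<lambda>h. - 2 * (h \<bullet> (x - z)))) (at x)" for x
    unfolding w_def power2_norm_eq_inner
    by (auto intro!: derivative_eq_intros simp: inner_commute)
  have g: "GDERIV (bump z \<rho>) x :> (- 6 * (s x)\<^sup>2) *\<^sub>R (x - z)" for x
  proof -
    have "(bump z \<rho> has_derivative (\<lambda>h. 3 * (max 0 (w x))\<^sup>2 * (- 2 * (h \<bullet> (x - z))))) (at x)"
      using has_derivative_compose[OF w
          has_real_derivative_pos_part_power[of 3, unfolded has_field_derivative_def]]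
      by (simp add: w_def bump_def[abs_def] mult.commute)
    then show ?thesis by (simp add: gderiv_def s_def w_def algebra_simps)
  qed
  have sq: "((\<lambda>x. (s x)\<^sup>2) has_derivative (\<lambda>h. - 4 * s x * (h \<bullet> (x - z)))) (at x)" for x
    using has_derivative_compose[OF w
        has_real_derivative_pos_part_power[of 2, unfolded has_field_derivative_def]]
    by (simp add: w_def s_def mult.commute mult.left_commute)
  have h: "((\<lambda>x. (- 6 * (s x)\<^sup>2) *\<^sub>R (x - z)) has_derivative
      (\<lambda>h. (- 6 * (s x)\<^sup>2) *\<^sub>R h + (24 * s x * (h \<bullet> (x - z))) *\<^sub>R (x - z))) (at x)" for x
  proof -
    have "((\<lambda>x. x - z) has_derivative (\<lambda>h. h)) (at x)"
      by (auto intro!: derivative_eq_intros)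
    from has_derivative_scaleR[OF has_derivative_mult_right[OF sq, of "- 6"] this]
    show ?thesis by (simp add: algebra_simps)
  qed
  have s_nonneg: "0 \<le> s x" for x by (simp add: s_def)
  have s_le: "s x \<le> \<rho>\<^sup>2" for x by (simp add: s_def)
  have s_zero: "s x = 0" if "norm (x - z) > \<rho>" for x
  proof -
    have "\<rho>\<^sup>2 \<le> (norm (x - z))\<^sup>2" using that assms by (intro power_mono) auto
    then show ?thesis by (simp add: s_def)
  qed
  have s2: "(s x)\<^sup>2 \<le> \<rho> ^ 4" for x
    using power_mono[OF s_le s_nonneg, of x 2] by (simp flip: power_mult)
  have b: "norm ((- 6 * (s x)\<^sup>2) *\<^sub>R (x - z)) \<le> 6 * \<rho> ^ 4 * \<rho> * (1 + norm x)" for x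
  proof (cases "norm (x - z) > \<rho>")
    case False
    have "6 * (s x)\<^sup>2 * norm (x - z) \<le> 6 * \<rho> ^ 4 * \<rho>"
      using s2[of x] False assms by (intro mult_mono) auto
    also have "\<dots> \<le> 6 * \<rho> ^ 4 * \<rho> * (1 + norm x)" using assms by (simp add: algebra_simps)
    finally show ?thesis by simp
  qed (use s_zero assms in simp)
  have sum: "(\<Sum>b\<in>Basis. ((- 6 * (s x)\<^sup>2) *\<^sub>R b + (24 * s x * (b \<bullet> (x - z))) *\<^sub>R (x - z)) \<bullet> b)
      = 24 * s x * (norm (x - z))\<^sup>2 - 6 * real DIM('a) * (s x)\<^sup>2" for x
  proof -
    have "(\<Sum>b\<in>Basis. ((- 6 * (s x)\<^sup>2) *\<^sub>R b + (24 * s x * (b \<bullet> (x - z))) *\<^sub>R (x - z)) \<bullet> b)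
      = (\<Sum>b\<in>Basis. - 6 * (s x)\<^sup>2 + 24 * s x * ((x - z) \<bullet> b * ((x - z) \<bullet> b)))"
      by (intro sum.cong refl) (simp add: inner_add_left inner_Basis inner_commute algebra_simps)
    also have "\<dots> = - 6 * real DIM('a) * (s x)\<^sup>2 + 24 * s x * ((x - z) \<bullet> (x - z))"
      by (simp add: sum.distrib sum_subtractf sum_distrib_left[symmetric] euclidean_inner[of "x - z" "x - z"])
    finally show ?thesis by (simp add: power2_norm_eq_inner)
  qed
  have l: "\<bar>24 * s x * (norm (x - z))\<^sup>2 - 6 * real DIM('a) * (s x)\<^sup>2\<bar>
      \<le> 24 * \<rho>\<^sup>2 * \<rho>\<^sup>2 + 6 * real DIM('a) * \<rho> ^ 4" for x
  proof (cases "norm (x - z) > \<rho>")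
    case False
    have "24 * s x * (norm (x - z))\<^sup>2 \<le> 24 * \<rho>\<^sup>2 * \<rho>\<^sup>2"
      using s_le[of x] s_nonneg[of x] False by (intro mult_mono power_mono) auto
    moreover have "6 * real DIM('a) * (s x)\<^sup>2 \<le> 6 * real DIM('a) * \<rho> ^ 4"
      using s2[of x] by (intro mult_left_mono) auto
    moreover have "0 \<le> 24 * s x * (norm (x - z))\<^sup>2" "0 \<le> 6 * real DIM('a) * (s x)\<^sup>2"
      using s_nonneg[of x] by auto
    ultimately show ?thesis by linarith
  qed (use s_zero assms in simp)
  have "continuous_on UNIV (\<lambda>x. (- 6 * (s x)\<^sup>2) *\<^sub>R b + (24 * s x * (b \<bullet> (x - z))) *\<^sub>R (x - z))"
    for b :: 'a
    unfolding s_def by (intro continuous_intros)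
  note * = C2_starI[OF g h this b, unfolded sum, OF l]
  show "bump z \<rho> \<in> C2_star" by (rule *(1))
  show "gradient (bump z \<rho>) = (\<lambda>x. (- 6 * (s x)\<^sup>2) *\<^sub>R (x - z))" using *(2) by simp
  show "laplacian (bump z \<rho>) =
      (\<lambda>x. 24 * s x * (norm (x - z))\<^sup>2 - 6 * real DIM('a) * (s x)\<^sup>2)" by (rule *(3))
qed

lemma bump_nonneg: "0 \<le> bump z \<rho> x"
  by (simp add: bump_def)

lemma bump_le: "bump z \<rho> x \<le> \<rho> ^ 6"
  using power_mono[of "max 0 (\<rho>\<^sup>2 - (norm (x - z))\<^sup>2)" "\<rho>\<^sup>2" 3]
  by (simp add: bump_def flip: power_mult)

lemma bump_eq_0:
  assumes "norm (x - z) \<ge> \<rho>" "\<rho> > 0"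
  shows "bump z \<rho> x = 0"
  using power_mono[of \<rho> "norm (x - z)" 2] assms by (simp add: bump_def)

lemma bump_pos:
  assumes "norm (x - z) < \<rho>"
  shows "bump z \<rho> x > 0"
  using power_strict_mono[OF assms norm_ge_zero, of 2] by (simp add: bump_def)

section \<open>Integrals along curves that are continuous for the Wasserstein distance\<close>

lemma P4_prob_space: "\<mu> \<in> P4 \<Longrightarrow> prob_space \<mu>"
  by (simp add: P4_def)

lemma P4_sets: "\<mu> \<in> P4 \<Longrightarrow> sets \<mu> = sets borel"
  by (simp add: P4_def)

lemma P4_measurable:
  "\<mu> \<in> P4 \<Longrightarrow> continuous_on UNIV g \<Longrightarrow> g \<in> borel_measurable \<mu>"
  using borel_measurable_continuous_onI measurable_cong_sets[OF P4_sets refl] by blast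

text \<open>Quadratic growth is dominated by the fourth moment, through
  \<open>(1 + n)^2 \<le> 3 + n^4\<close>, a sum of two squares.\<close>
lemma P4_integrable:
  fixes g :: "'a::euclidean_space \<Rightarrow> 'b::{banach, second_countable_topology}"
  assumes \<mu>: "\<mu> \<in> P4" and g: "continuous_on UNIV g"
    and growth: "\<And>x. norm (g x) \<le> A * (1 + norm x)\<^sup>2"
  shows "integrable \<mu> g"
proof (rule Bochner_Integration.integrable_bound)
  interpret prob_space \<mu> by (rule P4_prob_space[OF \<mu>])
  show "integrable \<mu> (\<lambda>x. \<bar>A\<bar> * (3 + norm x ^ 4))"
    using \<mu> by (simp add: P4_def)
  show "g \<in> borel_measurable \<mu>" by (rule P4_measurable[OF \<mu> g])
  have "norm (g x) \<le> norm (\<bar>A\<bar> * (3 + norm x ^ 4))" for x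
  proof -
    have "(1 + norm x)\<^sup>2 = 3 + norm x ^ 4 - (norm x - 1)\<^sup>2 - ((norm x)\<^sup>2 - 1)\<^sup>2"
      by (simp add: algebra_simps power2_eq_square power4_eq_xxxx)
    then have "(1 + norm x)\<^sup>2 \<le> 3 + norm x ^ 4"
      by (smt (verit) zero_le_power2)
    then have "\<bar>A\<bar> * (1 + norm x)\<^sup>2 \<le> \<bar>A\<bar> * (3 + norm x ^ 4)"
      by (rule mult_left_mono) simp
    moreover have "A * (1 + norm x)\<^sup>2 \<le> \<bar>A\<bar> * (1 + norm x)\<^sup>2"
      by (rule mult_right_mono) auto
    ultimately show ?thesis using growth[of x] by simp
  qed
  then show "AE x in \<mu>. norm (g x) \<le> norm (\<bar>A\<bar> * (3 + norm x ^ 4))" by simp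
qed

text \<open>Needed because the infimum of the empty set of reals is arbitrary: the product measure makes the
  cost bounded below an infimum over a nonempty set.\<close>
lemma couplings_nonempty:
  assumes "\<mu> \<in> P4" "\<nu> \<in> P4"
  shows "couplings \<mu> \<nu> \<noteq> {}"
proof -
  interpret \<mu>: prob_space \<mu> by (rule P4_prob_space[OF assms(1)])
  interpret \<nu>: prob_space \<nu> by (rule P4_prob_space[OF assms(2)])
  note sets[measurable_cong] = P4_sets[OF assms(1)] P4_sets[OF assms(2)]
  have "distr (\<mu> \<Otimes>\<^sub>M \<nu>) borel fst = \<mu>"
    using \<nu>.distr_pair_fst[of \<mu>] distr_cong[OF refl sets(1), of "\<mu> \<Otimes>\<^sub>M \<nu>" fst fst] by simp
  moreover have "distr (\<mu> \<Otimes>\<^sub>M \<nu>) borel snd = \<nu>"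
  proof (rule measure_eqI)
    fix A assume "A \<in> sets (distr (\<mu> \<Otimes>\<^sub>M \<nu>) borel snd)"
    then have A: "A \<in> sets \<nu>" by (simp add: sets)
    have "emeasure (distr (\<mu> \<Otimes>\<^sub>M \<nu>) borel snd) A
        = emeasure (\<mu> \<Otimes>\<^sub>M \<nu>) (snd -` A \<inter> space (\<mu> \<Otimes>\<^sub>M \<nu>))"
      using A by (intro emeasure_distr) (auto simp: sets)
    also have "snd -` A \<inter> space (\<mu> \<Otimes>\<^sub>M \<nu>) = space \<mu> \<times> A"
      using sets.sets_into_space[OF A] by (auto simp: space_pair_measure)
    also have "emeasure (\<mu> \<Otimes>\<^sub>M \<nu>) (space \<mu> \<times> A) = emeasure \<nu> A"
      using A by (simp add: \<nu>.emeasure_pair_measure_Times \<mu>.emeasure_space_1)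
    finally show "emeasure (distr (\<mu> \<Otimes>\<^sub>M \<nu>) borel snd) A = emeasure \<nu> A" .
  qed (simp add: sets)
  moreover have "sets (\<mu> \<Otimes>\<^sub>M \<nu>) = sets (borel \<Otimes>\<^sub>M borel)"
    using sets by (rule sets_pair_measure_cong)
  ultimately show ?thesis unfolding couplings_def by blast
qed

lemma W4_less_obtains_coupling:
  assumes "\<mu> \<in> P4" "\<nu> \<in> P4" "W4 \<mu> \<nu> < e"
  obtains \<pi> where "\<pi> \<in> couplings \<mu> \<nu>" "(LINT z|\<pi>. norm (fst z - snd z) ^ 4) < e ^ 4" "0 < e"
proof -
  define I where "I = (INF \<pi>\<in>couplings \<mu> \<nu>. LINT z|\<pi>. norm (fst z - snd z) ^ 4)"
  have I: "0 \<le> I" unfolding I_def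
    by (rule cINF_greatest[OF couplings_nonempty[OF assms(1,2)]]) simp
  have W: "W4 \<mu> \<nu> = root 4 I" by (simp add: W4_def I_def)
  have W0: "0 \<le> root 4 I" using I by simp
  have "root 4 I ^ 4 < e ^ 4" using assms(3) W W0 by (intro power_strict_mono) auto
  then have "I < e ^ 4" using I by simp
  then obtain \<pi> where "\<pi> \<in> couplings \<mu> \<nu>" "(LINT z|\<pi>. norm (fst z - snd z) ^ 4) < e ^ 4"
    unfolding I_def using cInf_lessD[of "(\<lambda>\<pi>. LINT z|\<pi>. norm (fst z - snd z) ^ 4) ` couplings \<mu> \<nu>"]
      couplings_nonempty[OF assms(1,2)] by auto
  moreover have "0 < e" using W W0 assms(3) by linarith
  ultimately show ?thesis by (rule that)
qed

text \<open>Two applications of Young's inequality \<open>x * y \<le> (k * x^2 + y^2 / k) / 2\<close>, with weights chosen so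
  that inserting \<open>b^4 \<approx> e^4\<close> makes the right-hand side of order \<open>e\<close>. Here \<open>b\<close> stands for the
  distance moved and \<open>m\<close> for the norm of the end point.\<close>
lemma transport_modulus:
  fixes b m e :: real
  assumes "0 < e"
  shows "(1 + 2 * m) * b + b\<^sup>2 \<le> e / 2 * (1 + 2 * m)\<^sup>2 + (1 / (2 * e) + 1) * ((e\<^sup>2 + b ^ 4 / e\<^sup>2) / 2)"
proof -
  have *: "x * y \<le> (k * x\<^sup>2 + y\<^sup>2 / k) / 2" if "k > 0" for x y k :: real
  proof -
    have "(k * x\<^sup>2 + y\<^sup>2 / k) / 2 - x * y = (k * x - y)\<^sup>2 / (2 * k)"
      using that by (simp add: power2_eq_square field_simps)
    moreover have "0 \<le> (k * x - y)\<^sup>2 / (2 * k)" using that by simp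
    ultimately show ?thesis by linarith
  qed
  have 1: "(1 + 2 * m) * b \<le> e / 2 * (1 + 2 * m)\<^sup>2 + 1 / (2 * e) * b\<^sup>2"
    using *[OF assms, of "1 + 2 * m" b] by (simp add: field_simps)
  have "b\<^sup>2 \<le> (e\<^sup>2 + b ^ 4 / e\<^sup>2) / 2"
    using *[of "e\<^sup>2" 1 "b\<^sup>2"] assms by (simp flip: power_mult)
  then have "(1 / (2 * e) + 1) * b\<^sup>2 \<le> (1 / (2 * e) + 1) * ((e\<^sup>2 + b ^ 4 / e\<^sup>2) / 2)"
    using assms by (intro mult_left_mono) auto
  with 1 show ?thesis by (simp only: distrib_right)
qed

text \<open>Couple the two measures at cost below \<open>e^4\<close> and integrate the modulus of continuity of \<open>\<phi>\<close>. The
  factor \<open>1 + norm x + norm y\<close> is at most \<open>1 + 2 * norm y + norm (x - y)\<close>, so that only a moment of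
  the fixed measure \<open>\<nu>\<close> remains.\<close>
lemma integral_diff_le_W4:
  fixes \<phi> :: "'a::euclidean_space \<Rightarrow> real"
  assumes \<mu>: "\<mu> \<in> P4" and \<nu>: "\<nu> \<in> P4" and e: "W4 \<mu> \<nu> < e" "e \<le> 1"
    and int: "integrable \<mu> \<phi>" "integrable \<nu> \<phi>" and "0 \<le> C"
    and lip: "\<And>x y. \<bar>\<phi> x - \<phi> y\<bar> \<le> C * (1 + norm x + norm y) * norm (x - y)"
  shows "\<bar>(LINT x|\<mu>. \<phi> x) - (LINT x|\<nu>. \<phi> x)\<bar> \<le> C * e * ((LINT x|\<nu>. (1 + 2 * norm x)\<^sup>2) + 2)"
proof -
  obtain \<pi> where \<pi>: "\<pi> \<in> couplings \<mu> \<nu>" and cost: "(LINT z|\<pi>. norm (fst z - snd z) ^ 4) < e ^ 4"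
    and "0 < e" using W4_less_obtains_coupling[OF \<mu> \<nu> e(1)] .
  have sets_\<pi>[measurable_cong]: "sets \<pi> = sets (borel \<Otimes>\<^sub>M borel)"
    and d: "distr \<pi> borel fst = \<mu>" "distr \<pi> borel snd = \<nu>"
    using \<pi> by (auto simp: couplings_def)
  have proj: "fst \<in> \<pi> \<rightarrow>\<^sub>M borel" "snd \<in> \<pi> \<rightarrow>\<^sub>M borel" by measurable
  interpret prob_space \<pi>
    using prob_space_distrD[OF proj(1)] P4_prob_space[OF \<mu>] d(1) by simp
  have meas: "g \<in> borel_measurable borel" if "integrable \<mu> g" for g :: "'a \<Rightarrow> real"
    using borel_measurable_integrable[OF that] measurable_cong_sets[OF P4_sets[OF \<mu>] refl] by blast
  have meas': "g \<in> borel_measurable borel" if "integrable \<nu> g" for g :: "'a \<Rightarrow> real"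
    using borel_measurable_integrable[OF that] measurable_cong_sets[OF P4_sets[OF \<nu>] refl] by blast
  have fst: "integrable \<pi> (\<lambda>z. g (fst z)) \<and> (LINT z|\<pi>. g (fst z)) = (LINT x|\<mu>. g x)"
    if "integrable \<mu> g" for g :: "'a \<Rightarrow> real"
    using that integrable_distr_eq[OF proj(1) meas[OF that]] integral_distr[OF proj(1) meas[OF that]]
    unfolding d by simp
  have snd: "integrable \<pi> (\<lambda>z. g (snd z)) \<and> (LINT z|\<pi>. g (snd z)) = (LINT x|\<nu>. g x)"
    if "integrable \<nu> g" for g :: "'a \<Rightarrow> real"
    using that integrable_distr_eq[OF proj(2) meas'[OF that]] integral_distr[OF proj(2) meas'[OF that]]
    unfolding d by simp
  have "integrable \<mu> (\<lambda>x. norm x ^ 4)" "integrable \<nu> (\<lambda>x. norm x ^ 4)"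
    using \<mu> \<nu> by (auto simp: P4_def)
  then have m4: "integrable \<pi> (\<lambda>z. norm (fst z) ^ 4)" "integrable \<pi> (\<lambda>z. norm (snd z) ^ 4)"
    using fst snd by blast+
  have b4: "integrable \<pi> (\<lambda>z. norm (fst z - snd z) ^ 4)"
  proof (rule Bochner_Integration.integrable_bound)
    show "integrable \<pi> (\<lambda>z. 8 * norm (fst z) ^ 4 + 8 * norm (snd z) ^ 4)" using m4 by simp
    have "norm (x - y) ^ 4 \<le> 8 * norm x ^ 4 + 8 * norm y ^ 4" for x y :: 'a
    proof -
      have sq: "(p + q)\<^sup>2 \<le> 2 * p\<^sup>2 + 2 * q\<^sup>2" for p q :: real
        using sum_squares_bound[of p q] by (simp add: power2_sum)
      have "norm (x - y) ^ 4 \<le> (norm x + norm y) ^ 4"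
        by (intro power_mono norm_triangle_ineq4) simp
      also have "\<dots> = ((norm x + norm y)\<^sup>2)\<^sup>2" by simp
      also have "\<dots> \<le> (2 * (norm x)\<^sup>2 + 2 * (norm y)\<^sup>2)\<^sup>2"
        by (intro power_mono sq) simp
      also have "\<dots> \<le> 2 * (2 * (norm x)\<^sup>2)\<^sup>2 + 2 * (2 * (norm y)\<^sup>2)\<^sup>2" by (rule sq)
      finally show ?thesis by (simp add: power_mult_distrib)
    qed
    then show "AE z in \<pi>. norm (norm (fst z - snd z) ^ 4)
        \<le> norm (8 * norm (fst z) ^ 4 + 8 * norm (snd z) ^ 4)" by simp
  qed measurable
  have q: "integrable \<nu> (\<lambda>x. (1 + 2 * norm x)\<^sup>2)"
  proof (rule P4_integrable[OF \<nu>])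
    show "norm ((1 + 2 * norm x)\<^sup>2) \<le> 4 * (1 + norm x)\<^sup>2" for x :: 'a
      using power_mono[of "1 + 2 * norm x" "2 * (1 + norm x)" 2]
      unfolding power_mult_distrib[of 2] by simp
  qed (intro continuous_intros)
  have "\<bar>(LINT x|\<mu>. \<phi> x) - (LINT x|\<nu>. \<phi> x)\<bar> = \<bar>LINT z|\<pi>. \<phi> (fst z) - \<phi> (snd z)\<bar>"
    using fst[OF int(1)] snd[OF int(2)] by simp
  also have "\<dots> \<le> (LINT z|\<pi>. \<bar>\<phi> (fst z) - \<phi> (snd z)\<bar>)"
    using integral_norm_bound[of \<pi> "\<lambda>z. \<phi> (fst z) - \<phi> (snd z)"] by simp
  also have "\<dots> \<le> (LINT z|\<pi>. C * (e / 2 * (1 + 2 * norm (snd z))\<^sup>2 +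
      (1 / (2 * e) + 1) * ((e\<^sup>2 + norm (fst z - snd z) ^ 4 / e\<^sup>2) / 2)))"
  proof (rule integral_mono)
    show "integrable \<pi> (\<lambda>z. \<bar>\<phi> (fst z) - \<phi> (snd z)\<bar>)"
      using fst[OF int(1)] snd[OF int(2)] by simp
    show "integrable \<pi> (\<lambda>z. C * (e / 2 * (1 + 2 * norm (snd z))\<^sup>2 +
      (1 / (2 * e) + 1) * ((e\<^sup>2 + norm (fst z - snd z) ^ 4 / e\<^sup>2) / 2)))"
      using snd[OF q] b4 by auto
    fix z :: "'a \<times> 'a"
    have "norm (fst z) \<le> norm (snd z) + norm (fst z - snd z)"
      using norm_triangle_sub by blast
    then have "(1 + norm (fst z) + norm (snd z)) * norm (fst z - snd z)
        \<le> (1 + (norm (snd z) + norm (fst z - snd z)) + norm (snd z)) * norm (fst z - snd z)"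
      by (intro mult_right_mono) auto
    also have "\<dots> = (1 + 2 * norm (snd z)) * norm (fst z - snd z) + (norm (fst z - snd z))\<^sup>2"
      by (simp add: algebra_simps power2_eq_square)
    also note transport_modulus[OF \<open>0 < e\<close>, of "norm (snd z)" "norm (fst z - snd z)"]
    finally have "C * ((1 + norm (fst z) + norm (snd z)) * norm (fst z - snd z)) \<le>
      C * (e / 2 * (1 + 2 * norm (snd z))\<^sup>2 +
      (1 / (2 * e) + 1) * ((e\<^sup>2 + norm (fst z - snd z) ^ 4 / e\<^sup>2) / 2))"
      using \<open>0 \<le> C\<close> by (rule mult_left_mono)
    then show "\<bar>\<phi> (fst z) - \<phi> (snd z)\<bar> \<le> C * (e / 2 * (1 + 2 * norm (snd z))\<^sup>2 +
      (1 / (2 * e) + 1) * ((e\<^sup>2 + norm (fst z - snd z) ^ 4 / e\<^sup>2) / 2))"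
      using lip[of "fst z" "snd z"] by (simp add: mult.assoc)
  qed
  also have "\<dots> = C * (e / 2 * (LINT x|\<nu>. (1 + 2 * norm x)\<^sup>2) +
      (1 / (2 * e) + 1) * ((e\<^sup>2 + (LINT z|\<pi>. norm (fst z - snd z) ^ 4) / e\<^sup>2) / 2))"
    using snd[OF q] b4 by (simp add: prob_space)
  also have "\<dots> \<le> C * (e / 2 * (LINT x|\<nu>. (1 + 2 * norm x)\<^sup>2) +
      (1 / (2 * e) + 1) * ((e\<^sup>2 + e ^ 4 / e\<^sup>2) / 2))"
    using cost \<open>0 < e\<close> \<open>0 \<le> C\<close>
    by (intro mult_left_mono add_left_mono divide_right_mono) auto
  also have "(1 / (2 * e) + 1) * ((e\<^sup>2 + e ^ 4 / e\<^sup>2) / 2) = e / 2 + e * e"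
    using \<open>0 < e\<close> by (simp add: field_simps power2_eq_square power4_eq_xxxx)
  also have "C * (e / 2 * (LINT x|\<nu>. (1 + 2 * norm x)\<^sup>2) + (e / 2 + e * e))
      \<le> C * (e * ((LINT x|\<nu>. (1 + 2 * norm x)\<^sup>2) + 2))"
  proof (rule mult_left_mono[OF _ \<open>0 \<le> C\<close>])
    have "0 \<le> (LINT x|\<nu>. (1 + 2 * norm x)\<^sup>2)" by simp
    then have "e / 2 * (LINT x|\<nu>. (1 + 2 * norm x)\<^sup>2) \<le> e * (LINT x|\<nu>. (1 + 2 * norm x)\<^sup>2)"
      using \<open>0 < e\<close> by (intro mult_right_mono) auto
    moreover have "e * e \<le> e * 1" using e(2) \<open>0 < e\<close> by (intro mult_left_mono) auto
    ultimately show "e / 2 * (LINT x|\<nu>. (1 + 2 * norm x)\<^sup>2) + (e / 2 + e * e)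
      \<le> e * ((LINT x|\<nu>. (1 + 2 * norm x)\<^sup>2) + 2)" using \<open>0 < e\<close> unfolding distrib_left by linarith
  qed
  finally show ?thesis by (simp add: mult.assoc)
qed

lemma C2_star_continuous:
  assumes "\<phi> \<in> C2_star"
  shows "continuous_on UNIV \<phi>" "continuous_on UNIV (gradient \<phi>)" "continuous_on UNIV (laplacian \<phi>)"
proof -
  have C2: "\<phi> \<in> C2" using assms by (simp add: C2_star_def)
  show "continuous_on UNIV \<phi>" "continuous_on UNIV (gradient \<phi>)"
    using C2 by (auto simp: C2_def differentiable_on_def intro!: differentiable_imp_continuous_on)
  show "continuous_on UNIV (laplacian \<phi>)"
    using C2 unfolding C2_def laplacian_def[abs_def]
    by (auto intro!: continuous_on_sum continuous_on_inner continuous_on_const)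
qed

lemma P4_integrable_C2_star:
  assumes "\<mu> \<in> P4" "\<phi> \<in> C2_star"
  shows "integrable \<mu> \<phi>"
proof -
  obtain C where C: "C \<ge> 0" "\<And>x y. \<bar>\<phi> x - \<phi> y\<bar> \<le> C * (1 + norm x + norm y) * norm (x - y)"
    using C2_star_lipschitz[OF assms(2)] by blast
  have "norm (\<phi> x) \<le> (\<bar>\<phi> 0\<bar> + C) * (1 + norm x)\<^sup>2" for x
  proof -
    have "\<bar>\<phi> x\<bar> \<le> \<bar>\<phi> 0\<bar> + C * ((1 + norm x) * norm x)"
      using C(2)[of x 0] by (simp add: mult.assoc)
    also have "\<dots> \<le> \<bar>\<phi> 0\<bar> * (1 + norm x)\<^sup>2 + C * (1 + norm x)\<^sup>2"
    proof (intro add_mono mult_left_mono C(1))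
      show "\<bar>\<phi> 0\<bar> \<le> \<bar>\<phi> 0\<bar> * (1 + norm x)\<^sup>2"
        using mult_left_mono[of 1 "(1 + norm x)\<^sup>2" "\<bar>\<phi> 0\<bar>"] by (simp add: one_le_power)
      show "(1 + norm x) * norm x \<le> (1 + norm x)\<^sup>2"
        unfolding power2_eq_square by (intro mult_left_mono) auto
    qed
    finally show ?thesis by (simp add: distrib_right)
  qed
  then show ?thesis by (rule P4_integrable[OF assms(1) C2_star_continuous(1)[OF assms(2)]])
qed

lemma P4_continuous_on_integral:
  assumes f: "P4_continuous_on S f" and \<phi>: "\<phi> \<in> C2_star"
  shows "continuous_on S (\<lambda>t. LINT x|f t. \<phi> x)"
  unfolding continuous_on_def
proof (intro ballI tendstoI)
  fix t and \<epsilon> :: real assume t: "t \<in> S" and "0 < \<epsilon>"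
  obtain C where C: "C \<ge> 0" "\<And>x y. \<bar>\<phi> x - \<phi> y\<bar> \<le> C * (1 + norm x + norm y) * norm (x - y)"
    using C2_star_lipschitz[OF \<phi>] by blast
  define A where "A = C * ((LINT x|f t. (1 + 2 * norm x)\<^sup>2) + 2)"
  have "A \<ge> 0" using C(1) by (simp add: A_def)
  define e where "e = min 1 (\<epsilon> / (2 * (A + 1)))"
  have e: "0 < e" "e \<le> 1" using \<open>0 < \<epsilon>\<close> \<open>A \<ge> 0\<close> by (auto simp: e_def)
  have "A * e \<le> (A + 1) * (\<epsilon> / (2 * (A + 1)))"
    using \<open>A \<ge> 0\<close> e by (intro mult_mono) (auto simp: e_def)
  also have "\<dots> = \<epsilon> / 2" using \<open>A \<ge> 0\<close> by (simp add: field_simps)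
  finally have Ae: "A * e < \<epsilon>" using \<open>0 < \<epsilon>\<close> by simp
  have P4: "f s \<in> P4" if "s \<in> S" for s using f that by (simp add: P4_continuous_on_def)
  have "((\<lambda>s. W4 (f s) (f t)) \<longlongrightarrow> 0) (at t within S)"
    using f t by (simp add: P4_continuous_on_def)
  then have "\<forall>\<^sub>F s in at t within S. W4 (f s) (f t) < e"
    using e(1) by (rule order_tendstoD)
  moreover have "\<forall>\<^sub>F s in at t within S. s \<in> S"
    by (simp add: eventually_at_filter)
  ultimately show "\<forall>\<^sub>F s in at t within S. dist (LINT x|f s. \<phi> x) (LINT x|f t. \<phi> x) < \<epsilon>"
  proof eventually_elim
    case (elim s)
    have "\<bar>(LINT x|f s. \<phi> x) - (LINT x|f t. \<phi> x)\<bar>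
        \<le> C * e * ((LINT x|f t. (1 + 2 * norm x)\<^sup>2) + 2)"
      using integral_diff_le_W4[OF P4[OF elim(2)] P4[OF t] elim(1) e(2)
          P4_integrable_C2_star[OF P4[OF elim(2)] \<phi>] P4_integrable_C2_star[OF P4[OF t] \<phi>] C] .
    then show ?case using Ae by (simp add: dist_real_def A_def mult_ac)
  qed
qed

section \<open>Evolution of mean square distances and of local mass\<close>

text \<open>The integrand of the weak formulation, with the consensus point frozen at \<open>X\<close>.\<close>
definition generator ::
  "real \<Rightarrow> real \<Rightarrow> 'a::euclidean_space \<Rightarrow> ('a \<Rightarrow> real) \<Rightarrow> 'a \<Rightarrow> real" where
  "generator lam \<sigma> X \<phi> x =
     - lam * ((x - X) \<bullet> gradient \<phi> x) + \<sigma>\<^sup>2 / 2 * ((norm (x - X))\<^sup>2 * laplacian \<phi> x)"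

lemma FP_solution_P4: "FP_solution lam \<sigma> \<alpha> F a b \<mu> f \<Longrightarrow> t \<in> {a..b} \<Longrightarrow> f t \<in> P4"
  by (simp add: FP_solution_def P4_continuous_on_def)

lemma FP_solution_derivative:
  fixes f :: "real \<Rightarrow> 'a::euclidean_space measure"
  assumes FP: "FP_solution lam \<sigma> \<alpha> F a b \<mu> f" and t: "t \<in> {a<..<b}" and \<phi>: "\<phi> \<in> C2_star"
  defines "X \<equiv> consensus_point \<alpha> F (f t)"
  shows "((\<lambda>s. LINT x|f s. \<phi> x) has_real_derivative (LINT x|f t. generator lam \<sigma> X \<phi> x)) (at t)"
    and "integrable (f t) (generator lam \<sigma> X \<phi>)"
proof -
  have P4: "f t \<in> P4" using FP t by (intro FP_solution_P4) auto
  obtain C where C: "\<And>x. norm (gradient \<phi> x) \<le> C * (1 + norm x)"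
    using \<phi> by (auto simp: C2_star_def)
  obtain L where L: "\<And>x. \<bar>laplacian \<phi> x\<bar> \<le> L"
    using \<phi> by (auto simp: C2_star_def bounded_iff)
  have drift: "integrable (f t) (\<lambda>x. (x - X) \<bullet> gradient \<phi> x)"
  proof (rule P4_integrable[OF P4])
    show "continuous_on UNIV (\<lambda>x. (x - X) \<bullet> gradient \<phi> x)"
      by (intro continuous_intros C2_star_continuous \<phi>)
    fix x
    have "\<bar>(x - X) \<bullet> gradient \<phi> x\<bar> \<le> norm (x - X) * norm (gradient \<phi> x)"
      by (rule Cauchy_Schwarz_ineq2)
    also have "\<dots> \<le> ((1 + norm X) * (1 + norm x)) * (C * (1 + norm x))"
      by (intro mult_mono norm_diff_le_affine C) auto
    finally show "norm ((x - X) \<bullet> gradient \<phi> x) \<le> ((1 + norm X) * C) * (1 + norm x)\<^sup>2"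
      by (simp add: power2_eq_square mult_ac)
  qed
  have diffusion: "integrable (f t) (\<lambda>x. (norm (x - X))\<^sup>2 * laplacian \<phi> x)"
  proof (rule P4_integrable[OF P4])
    show "continuous_on UNIV (\<lambda>x. (norm (x - X))\<^sup>2 * laplacian \<phi> x)"
      by (intro continuous_intros C2_star_continuous \<phi>)
    fix x
    have "(norm (x - X))\<^sup>2 * \<bar>laplacian \<phi> x\<bar> \<le> ((1 + norm X) * (1 + norm x))\<^sup>2 * L"
      by (intro mult_mono power_mono norm_diff_le_affine L) auto
    then show "norm ((norm (x - X))\<^sup>2 * laplacian \<phi> x) \<le> ((1 + norm X)\<^sup>2 * L) * (1 + norm x)\<^sup>2"
      by (simp add: abs_mult power_mult_distrib mult_ac)
  qed
  have "(LINT x|f t. generator lam \<sigma> X \<phi> x)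
      = - lam * (LINT x|f t. (x - X) \<bullet> gradient \<phi> x)
        + \<sigma>\<^sup>2 / 2 * (LINT x|f t. (norm (x - X))\<^sup>2 * laplacian \<phi> x)"
    unfolding generator_def using drift diffusion
    by (subst Bochner_Integration.integral_add) auto
  then show "((\<lambda>s. LINT x|f s. \<phi> x) has_real_derivative (LINT x|f t. generator lam \<sigma> X \<phi> x)) (at t)"
    using FP t \<phi> unfolding FP_solution_def X_def by simp
  show "integrable (f t) (generator lam \<sigma> X \<phi>)"
    unfolding generator_def[abs_def] using drift diffusion
    by (intro Bochner_Integration.integrable_add integrable_mult_right)
qed

lemma FP_solution_continuous_on:
  "FP_solution lam \<sigma> \<alpha> F a b \<mu> f \<Longrightarrow> \<phi> \<in> C2_star \<Longrightarrow> continuous_on {a..b} (\<lambda>t. LINT x|f t. \<phi> x)"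
  by (intro P4_continuous_on_integral) (auto simp: FP_solution_def)

definition decay_rate :: "real \<Rightarrow> real \<Rightarrow> nat \<Rightarrow> real" where
  "decay_rate lam \<sigma> d = (2 * lam - real d * \<sigma>\<^sup>2) / 2"

definition drift_cost :: "real \<Rightarrow> real \<Rightarrow> nat \<Rightarrow> real" where
  "drift_cost lam \<sigma> d =
     (lam + real d * \<sigma>\<^sup>2)\<^sup>2 / (2 * decay_rate lam \<sigma> d) + real d * \<sigma>\<^sup>2 / 2"

lemma half_msd_eq_integral: "half_msd z \<mu> = (LINT x|\<mu>. (norm (x - z))\<^sup>2 / 2)"
  by (simp add: half_msd_def)

text \<open>With \<open>y = x - z\<close> and \<open>v = X - z\<close> the generator is
  \<open>- \<kappa> * |y|^2 + (lam - d * \<sigma>^2) * (v \<bullet> y) + (d * \<sigma>^2 / 2) * |v|^2\<close>. Young's inequality absorbs the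
  mixed term into half of the dissipation; the price is \<^const>\<open>drift_cost\<close>.\<close>
lemma generator_half_sq_dist_le:
  fixes z :: "'a::euclidean_space"
  assumes "0 \<le> lam" "0 < decay_rate lam \<sigma> DIM('a)"
  shows "generator lam \<sigma> X (\<lambda>x. (norm (x - z))\<^sup>2 / 2) x
    \<le> - decay_rate lam \<sigma> DIM('a) * ((norm (x - z))\<^sup>2 / 2)
       + drift_cost lam \<sigma> DIM('a) * (norm (X - z))\<^sup>2"
proof -
  define d where "d = real DIM('a) * \<sigma>\<^sup>2"
  define k where "k = decay_rate lam \<sigma> DIM('a)"
  define y v where "y = x - z" and "v = X - z"
  have d: "0 \<le> d" by (simp add: d_def)
  have k: "0 < k" "2 * k = 2 * lam - d"
    using assms(2) by (simp_all add: k_def decay_rate_def d_def)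
  have xX: "x - X = y - v" by (simp add: y_def v_def)
  have "(lam - d) * (v \<bullet> y) \<le> \<bar>lam - d\<bar> * \<bar>v \<bullet> y\<bar>"
    by (metis abs_ge_self abs_mult)
  also have "\<dots> \<le> (lam + d) * (norm v * norm y)"
    using assms(1) d by (intro mult_mono Cauchy_Schwarz_ineq2) auto
  also have "\<dots> \<le> k / 2 * (norm y)\<^sup>2 + (lam + d)\<^sup>2 / (2 * k) * (norm v)\<^sup>2"
  proof -
    have "k / 2 * (norm y)\<^sup>2 + (lam + d)\<^sup>2 / (2 * k) * (norm v)\<^sup>2 - (lam + d) * (norm v * norm y)
        = (k * norm y - (lam + d) * norm v)\<^sup>2 / (2 * k)"
      using k(1) by (simp add: power2_eq_square field_simps)
    moreover have "0 \<le> (k * norm y - (lam + d) * norm v)\<^sup>2 / (2 * k)" using k(1) by simp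
    ultimately show ?thesis by linarith
  qed
  finally have cross: "(lam - d) * (v \<bullet> y)
      \<le> k / 2 * (norm y)\<^sup>2 + (lam + d)\<^sup>2 / (2 * k) * (norm v)\<^sup>2" .
  have "generator lam \<sigma> X (\<lambda>x. (norm (x - z))\<^sup>2 / 2) x
      = - lam * ((y - v) \<bullet> y) + d / 2 * (norm (y - v))\<^sup>2"
    unfolding generator_def half_sq_dist_C2_star xX by (simp add: y_def d_def)
  also have "\<dots> = - k * (norm y)\<^sup>2 + (lam - d) * (v \<bullet> y) + d / 2 * (norm v)\<^sup>2"
  proof -
    have lam: "lam = k + d / 2" using k(2) by simp
    show ?thesis unfolding lam
      by (simp add: power2_norm_eq_inner inner_diff_left inner_diff_right inner_commute field_simps)
  qed
  also have "\<dots> \<le> - k * ((norm y)\<^sup>2 / 2) + ((lam + d)\<^sup>2 / (2 * k) + d / 2) * (norm v)\<^sup>2"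
    using cross by (simp add: algebra_simps)
  finally show ?thesis by (simp add: k_def d_def drift_cost_def y_def v_def)
qed

lemma half_msd_derivative:
  fixes f :: "real \<Rightarrow> 'a::euclidean_space measure"
  assumes FP: "FP_solution lam \<sigma> \<alpha> F a b \<mu> f" and t: "t \<in> {a<..<b}"
    and "0 \<le> lam" "0 < decay_rate lam \<sigma> DIM('a)"
  obtains D where "((\<lambda>s. half_msd z (f s)) has_real_derivative D) (at t)"
    and "D \<le> - decay_rate lam \<sigma> DIM('a) * half_msd z (f t)
           + drift_cost lam \<sigma> DIM('a) * (norm (consensus_point \<alpha> F (f t) - z))\<^sup>2"
proof -
  define \<phi> where "\<phi> = (\<lambda>x::'a. (norm (x - z))\<^sup>2 / 2)"
  define X where "X = consensus_point \<alpha> F (f t)"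
  have \<phi>: "\<phi> \<in> C2_star" unfolding \<phi>_def by (rule half_sq_dist_C2_star)
  have P4: "f t \<in> P4" using FP t by (intro FP_solution_P4) auto
  interpret prob_space "f t" by (rule P4_prob_space[OF P4])
  note der = FP_solution_derivative[OF FP t \<phi>, folded X_def]
  have "(LINT x|f t. generator lam \<sigma> X \<phi> x)
      \<le> (LINT x|f t. - decay_rate lam \<sigma> DIM('a) * \<phi> x + drift_cost lam \<sigma> DIM('a) * (norm (X - z))\<^sup>2)"
  proof (rule integral_mono)
    show "generator lam \<sigma> X \<phi> x
        \<le> - decay_rate lam \<sigma> DIM('a) * \<phi> x + drift_cost lam \<sigma> DIM('a) * (norm (X - z))\<^sup>2" for x
      unfolding \<phi>_def by (rule generator_half_sq_dist_le[OF assms(3,4)])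
    show "integrable (f t) (\<lambda>x. - decay_rate lam \<sigma> DIM('a) * \<phi> x
        + drift_cost lam \<sigma> DIM('a) * (norm (X - z))\<^sup>2)"
      using P4_integrable_C2_star[OF P4 \<phi>] by simp
  qed (rule der(2))
  also have "\<dots> = - decay_rate lam \<sigma> DIM('a) * (LINT x|f t. \<phi> x)
      + drift_cost lam \<sigma> DIM('a) * (norm (X - z))\<^sup>2"
    using P4_integrable_C2_star[OF P4 \<phi>] by (simp add: prob_space)
  finally show ?thesis
    using der(1) that unfolding half_msd_eq_integral X_def \<phi>_def by blast
qed

definition bump_mass :: "'a::euclidean_space \<Rightarrow> real \<Rightarrow> 'a measure \<Rightarrow> real" where
  "bump_mass z \<rho> \<mu> = (LINT x|\<mu>. bump z \<rho> x)"

text \<open>The first summand is the price of the drift, the second that of the curvature of the bump; each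
  is what remains after completing a square in \<open>generator_bump_ge\<close>.\<close>
definition leak_rate :: "real \<Rightarrow> real \<Rightarrow> nat \<Rightarrow> real \<Rightarrow> real \<Rightarrow> real" where
  "leak_rate lam \<sigma> d \<rho> B =
     3 * lam\<^sup>2 / (2 * \<sigma>\<^sup>2) + 3 * \<sigma>\<^sup>2 * (\<rho> + B)\<^sup>2 * (real d + 2)\<^sup>2 / (8 * \<rho>\<^sup>2)"

text \<open>Let \<open>s = \<rho>^2 - r^2\<close> with \<open>r = |x - z|\<close> and \<open>\<delta> = |x - X|\<close>. The diffusion contributes
  \<open>12 * \<sigma>^2 * \<delta>^2 * r^2 * s\<close>, which is of lower order in \<open>s\<close> than the bump \<open>s^3\<close> itself. One half of
  it absorbs the outward-pointing part of the drift, at most \<open>6 * lam * s^2 * \<delta> * r\<close>: both are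
  homogeneous in \<open>\<delta> * r\<close>, so the loss is independent of how close \<open>x\<close> is to \<open>X\<close>. The other half
  absorbs \<open>3 * d * \<sigma>^2 * \<delta>^2 * s^2\<close>, where now \<open>\<delta> \<le> \<rho> + B\<close> is used.\<close>
lemma generator_bump_ge:
  fixes z X :: "'a::euclidean_space"
  assumes "0 \<le> lam" "0 < \<sigma>" "0 < \<rho>" "norm (X - z) \<le> B"
  shows "- leak_rate lam \<sigma> DIM('a) \<rho> B * bump z \<rho> x \<le> generator lam \<sigma> X (bump z \<rho>) x"
proof -
  define s where "s = max 0 (\<rho>\<^sup>2 - (norm (x - z))\<^sup>2)"
  define r where "r = norm (x - z)"
  define \<delta> where "\<delta> = norm (x - X)"
  define d where "d = real DIM('a)"
  have nonneg: "0 \<le> s" "0 \<le> r" "0 \<le> \<delta>" by (auto simp: s_def r_def \<delta>_def)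
  have gen: "generator lam \<sigma> X (bump z \<rho>) x
      = 6 * lam * s\<^sup>2 * ((x - X) \<bullet> (x - z)) + \<sigma>\<^sup>2 / 2 * (\<delta>\<^sup>2 * (24 * s * r\<^sup>2 - 6 * d * s\<^sup>2))"
    unfolding generator_def bump_C2_star[OF assms(3)] s_def r_def d_def \<delta>_def by simp
  have "- (\<delta> * r) \<le> (x - X) \<bullet> (x - z)"
    using Cauchy_Schwarz_ineq2[of "x - X" "x - z"] by (simp add: \<delta>_def r_def abs_le_iff)
  then have "6 * lam * s\<^sup>2 * (- (\<delta> * r)) \<le> 6 * lam * s\<^sup>2 * ((x - X) \<bullet> (x - z))"
    using assms(1) by (intro mult_left_mono) auto
  then have gen_ge: "generator lam \<sigma> X (bump z \<rho>) x \<ge>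
      (6 * \<sigma>\<^sup>2 * \<delta>\<^sup>2 * r\<^sup>2 * s - 6 * lam * s\<^sup>2 * \<delta> * r) + 3 * \<sigma>\<^sup>2 * \<delta>\<^sup>2 * s * (2 * r\<^sup>2 - d * s)"
    unfolding gen by (simp add: algebra_simps power2_eq_square)
  have drift: "6 * \<sigma>\<^sup>2 * \<delta>\<^sup>2 * r\<^sup>2 * s - 6 * lam * s\<^sup>2 * \<delta> * r \<ge> - (3 * lam\<^sup>2 / (2 * \<sigma>\<^sup>2)) * s ^ 3"
  proof -
    have "6 * \<sigma>\<^sup>2 * \<delta>\<^sup>2 * r\<^sup>2 * s - 6 * lam * s\<^sup>2 * \<delta> * r + 3 * lam\<^sup>2 / (2 * \<sigma>\<^sup>2) * s ^ 3
        = 6 * s * (\<sigma> * \<delta> * r - lam * s / (2 * \<sigma>))\<^sup>2"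
      using assms(2) by (simp add: power2_eq_square power3_eq_cube field_simps)
    moreover have "0 \<le> 6 * s * (\<sigma> * \<delta> * r - lam * s / (2 * \<sigma>))\<^sup>2" using nonneg by simp
    ultimately show ?thesis by linarith
  qed
  have diffusion: "3 * \<sigma>\<^sup>2 * \<delta>\<^sup>2 * s * (2 * r\<^sup>2 - d * s)
      \<ge> - (3 * \<sigma>\<^sup>2 * (\<rho> + B)\<^sup>2 * (d + 2)\<^sup>2 / (8 * \<rho>\<^sup>2)) * s ^ 3"
  proof (cases "s = 0")
    case False
    then have "s = \<rho>\<^sup>2 - r\<^sup>2" unfolding s_def r_def by linarith
    then have r2: "r\<^sup>2 = \<rho>\<^sup>2 - s" and r2_le: "r\<^sup>2 \<le> \<rho>\<^sup>2" using nonneg(1) by linarith+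
    have "r \<le> \<rho>" using power2_le_imp_le[OF r2_le] assms(3) by simp
    moreover have "\<delta> \<le> r + norm (X - z)"
      using norm_triangle_ineq4[of "x - z" "X - z"] by (simp add: \<delta>_def r_def)
    ultimately have \<delta>: "\<delta>\<^sup>2 \<le> (\<rho> + B)\<^sup>2" using assms(4) nonneg by (intro power_mono) auto
    define c where "c = (d + 2)\<^sup>2 / (8 * \<rho>\<^sup>2)"
    have "0 \<le> c" by (simp add: c_def)
    have "2 * r\<^sup>2 - d * s + c * s\<^sup>2 = 2 * (\<rho> - (d + 2) * s / (4 * \<rho>))\<^sup>2"
      unfolding r2 c_def using assms(3) by (simp add: power2_eq_square field_simps)
    moreover have "0 \<le> 2 * (\<rho> - (d + 2) * s / (4 * \<rho>))\<^sup>2" by simp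
    ultimately have "- (c * s\<^sup>2) \<le> 2 * r\<^sup>2 - d * s" by linarith
    then have "3 * \<sigma>\<^sup>2 * \<delta>\<^sup>2 * s * (- (c * s\<^sup>2)) \<le> 3 * \<sigma>\<^sup>2 * \<delta>\<^sup>2 * s * (2 * r\<^sup>2 - d * s)"
      using nonneg by (intro mult_left_mono) auto
    moreover have "3 * \<sigma>\<^sup>2 * s * (c * s\<^sup>2) * \<delta>\<^sup>2 \<le> 3 * \<sigma>\<^sup>2 * s * (c * s\<^sup>2) * (\<rho> + B)\<^sup>2"
      using nonneg \<delta> \<open>0 \<le> c\<close> by (intro mult_left_mono) auto
    moreover have "3 * \<sigma>\<^sup>2 * \<delta>\<^sup>2 * s * (- (c * s\<^sup>2)) = - (3 * \<sigma>\<^sup>2 * s * (c * s\<^sup>2) * \<delta>\<^sup>2)"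
      by simp
    moreover have "- (3 * \<sigma>\<^sup>2 * (\<rho> + B)\<^sup>2 * (d + 2)\<^sup>2 / (8 * \<rho>\<^sup>2)) * s ^ 3
        = - (3 * \<sigma>\<^sup>2 * s * (c * s\<^sup>2) * (\<rho> + B)\<^sup>2)"
      by (simp add: c_def power2_eq_square power3_eq_cube)
    ultimately show ?thesis by linarith
  qed simp
  have "bump z \<rho> x = s ^ 3" by (simp add: bump_def s_def)
  then show ?thesis
    using gen_ge drift diffusion by (simp add: leak_rate_def d_def distrib_right left_diff_distrib)
qed

lemma bump_mass_derivative:
  fixes f :: "real \<Rightarrow> 'a::euclidean_space measure"
  assumes FP: "FP_solution lam \<sigma> \<alpha> F a b \<mu> f" and t: "t \<in> {a<..<b}"
    and par: "0 \<le> lam" "0 < \<sigma>" "0 < \<rho>" and X: "norm (consensus_point \<alpha> F (f t) - z) \<le> B"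
  obtains D where "((\<lambda>s. bump_mass z \<rho> (f s)) has_real_derivative D) (at t)"
    and "D \<ge> - leak_rate lam \<sigma> DIM('a) \<rho> B * bump_mass z \<rho> (f t)"
proof -
  have P4: "f t \<in> P4" using FP t by (intro FP_solution_P4) auto
  note \<phi> = bump_C2_star(1)[OF par(3), of z]
  note der = FP_solution_derivative[OF FP t \<phi>]
  have "- leak_rate lam \<sigma> DIM('a) \<rho> B * bump_mass z \<rho> (f t)
      = (LINT x|f t. - leak_rate lam \<sigma> DIM('a) \<rho> B * bump z \<rho> x)"
    by (simp add: bump_mass_def)
  also have "\<dots> \<le> (LINT x|f t. generator lam \<sigma> (consensus_point \<alpha> F (f t)) (bump z \<rho>) x)"
    using der(2) P4_integrable_C2_star[OF P4 \<phi>] generator_bump_ge[OF par X]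
    by (intro integral_mono) auto
  finally show ?thesis using der(1) by (intro that) (simp_all add: bump_mass_def)
qed

lemma FP_solution_bump_mass_ge:
  fixes f :: "real \<Rightarrow> 'a::euclidean_space measure"
  assumes FP: "FP_solution lam \<sigma> \<alpha> F a b \<mu> f" and t: "t \<in> {a..b}"
    and par: "0 \<le> lam" "0 < \<sigma>" "0 < \<rho>"
    and X: "\<And>s. s \<in> {a<..<t} \<Longrightarrow> norm (consensus_point \<alpha> F (f s) - z) \<le> B"
  shows "bump_mass z \<rho> (f a) * exp (- leak_rate lam \<sigma> DIM('a) \<rho> B * (t - a)) \<le> bump_mass z \<rho> (f t)"
proof -
  define q where "q = leak_rate lam \<sigma> DIM('a) \<rho> B"
  define \<Phi> where "\<Phi> = (\<lambda>s. bump_mass z \<rho> (f s))"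
  have "\<Phi> a * exp (q * (a - a)) \<le> \<Phi> t * exp (q * (t - a))"
  proof (rule DERIV_nonneg_imp_increasing_open[of a t "\<lambda>s. \<Phi> s * exp (q * (s - a))"])
    fix s assume s: "a < s" "s < t"
    then have "s \<in> {a<..<b}" "s \<in> {a<..<t}" using t by auto
    from bump_mass_derivative[OF FP this(1) par X[OF this(2)]]
    obtain D where D: "(\<Phi> has_real_derivative D) (at s)" "- q * \<Phi> s \<le> D"
      unfolding \<Phi>_def q_def by blast
    have "((\<lambda>s. \<Phi> s * exp (q * (s - a))) has_real_derivative (D + q * \<Phi> s) * exp (q * (s - a))) (at s)"
      by (auto intro!: derivative_eq_intros D(1) simp: algebra_simps)
    moreover have "0 \<le> (D + q * \<Phi> s) * exp (q * (s - a))" using D(2) by simp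
    ultimately show "\<exists>y. ((\<lambda>s. \<Phi> s * exp (q * (s - a))) has_real_derivative y) (at s) \<and> 0 \<le> y"
      by blast
  next
    have "continuous_on {a..b} \<Phi>" unfolding \<Phi>_def bump_mass_def
      by (rule FP_solution_continuous_on[OF FP bump_C2_star(1)[OF par(3)]])
    then have "continuous_on {a..t} \<Phi>" by (rule continuous_on_subset) (use t in auto)
    then show "continuous_on {a..t} (\<lambda>s. \<Phi> s * exp (q * (s - a)))" by (intro continuous_intros)
  qed (use t in auto)
  then have "\<Phi> a * exp (- q * (t - a)) \<le> \<Phi> t * exp (q * (t - a)) * exp (- q * (t - a))"
    by (intro mult_right_mono) auto
  also have "\<dots> = \<Phi> t" by (simp add: mult.assoc flip: exp_add)
  finally show ?thesis by (simp add: \<Phi>_def q_def)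
qed

text \<open>The hypothesis bounds the right-hand side of the differential inequality, so that one statement
  serves both for the growth in the first phase and for the decay in the second.\<close>
lemma FP_solution_half_msd_le:
  fixes f :: "real \<Rightarrow> 'a::euclidean_space measure"
  assumes FP: "FP_solution lam \<sigma> \<alpha> F a b \<mu> f" and t: "t \<in> {a..b}"
    and par: "0 \<le> lam" "0 < decay_rate lam \<sigma> DIM('a)"
    and rate: "\<And>s. s \<in> {a<..<t} \<Longrightarrow>
      - decay_rate lam \<sigma> DIM('a) * half_msd z (f s)
        + drift_cost lam \<sigma> DIM('a) * (norm (consensus_point \<alpha> F (f s) - z))\<^sup>2 \<le> c"
  shows "half_msd z (f t) \<le> half_msd z (f a) + c * (t - a)"
proof -
  define U where "U = (\<lambda>s. half_msd z (f s))"
  have "c * (a - a) - U a \<le> c * (t - a) - U t"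
  proof (rule DERIV_nonneg_imp_increasing_open[of a t "\<lambda>s. c * (s - a) - U s"])
    fix s assume s: "a < s" "s < t"
    then have s': "s \<in> {a<..<b}" "s \<in> {a<..<t}" using t by auto
    from half_msd_derivative[OF FP s'(1) par, of z] rate[OF s'(2)]
    obtain D where D: "(U has_real_derivative D) (at s)" "D \<le> c"
      unfolding U_def by (metis (no_types, lifting) order_trans)
    have "((\<lambda>s. c * (s - a) - U s) has_real_derivative c - D) (at s)"
      by (auto intro!: derivative_eq_intros D(1))
    then show "\<exists>y. ((\<lambda>s. c * (s - a) - U s) has_real_derivative y) (at s) \<and> 0 \<le> y"
      using D(2) by (intro exI conjI) auto
  next
    have "continuous_on {a..b} U" unfolding U_def half_msd_eq_integral
      by (rule FP_solution_continuous_on[OF FP half_sq_dist_C2_star(1)])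
    then have "continuous_on {a..t} U" by (rule continuous_on_subset) (use t in auto)
    then show "continuous_on {a..t} (\<lambda>s. c * (s - a) - U s)" by (intro continuous_intros)
  qed (use t in auto)
  then show ?thesis by (simp add: U_def)
qed

section \<open>Laplace principle and bootstrap\<close>

text \<open>Split the weighted average of \<open>x - z\<close> at distance \<open>e\<close>. The near part contributes at most \<open>e\<close>. The
  far part carries weights at most \<open>exp (- \<alpha> * (F z + \<gamma>))\<close>, whereas the bump mass alone makes the
  normalization at least \<open>exp (- \<alpha> * (F z + \<gamma> / 2)) * c / \<rho> ^ 6\<close>; the quotient decays like
  \<open>exp (- \<alpha> * \<gamma> / 2)\<close>.\<close>
lemma consensus_point_minus_le:
  fixes z :: "'a::euclidean_space"
  assumes F: "continuous_on UNIV F" and min: "\<And>x. F z \<le> F x"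
    and sep: "\<And>x. e \<le> norm (x - z) \<Longrightarrow> F z + \<gamma> \<le> F x"
    and flat: "\<And>x. norm (x - z) \<le> \<rho> \<Longrightarrow> F x \<le> F z + \<gamma> / 2"
    and pos: "0 \<le> e" "0 < \<rho>" "0 < c" "0 < \<alpha>"
    and \<mu>: "\<mu> \<in> P4" "c \<le> bump_mass z \<rho> \<mu>" "half_msd z \<mu> \<le> u"
  shows "norm (consensus_point \<alpha> F \<mu> - z) \<le> e + exp (- (\<alpha> * \<gamma> / 2)) * ((1 / 2 + u) * \<rho> ^ 6 / c)"
proof -
  interpret prob_space \<mu> by (rule P4_prob_space[OF \<mu>(1)])
  define w where "w = (\<lambda>x. exp (- \<alpha> * F x))"
  define W where "W = (LINT x|\<mu>. w x)"
  have w_cont: "continuous_on UNIV w" unfolding w_def by (intro continuous_intros F)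
  have w: "0 \<le> w x" "w x \<le> w z" for x using min[of x] pos by (auto simp: w_def)
  have one: "1 \<le> (1 + norm x)\<^sup>2" for x :: 'a by (simp add: one_le_power)
  have lin: "norm x \<le> (1 + norm x)\<^sup>2" for x :: 'a by (simp add: power2_sum)
  have int_w: "integrable \<mu> w"
  proof (rule P4_integrable[OF \<mu>(1) w_cont])
    show "norm (w x) \<le> w z * (1 + norm x)\<^sup>2" for x
      using mult_mono[OF w(2)[of x] one[of x]] w(1)[of x] w(1)[of z] by simp
  qed
  have int_wx: "integrable \<mu> (\<lambda>x. w x *\<^sub>R x)"
  proof (rule P4_integrable[OF \<mu>(1)])
    show "norm (w x *\<^sub>R x) \<le> w z * (1 + norm x)\<^sup>2" for x
      using mult_mono[OF w(2)[of x] lin[of x]] w(1)[of x] w(1)[of z] by simp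
  qed (intro continuous_intros w_cont)
  have int_dev: "integrable \<mu> (\<lambda>x. w x *\<^sub>R (x - z))"
    using int_wx int_w by (simp add: scaleR_diff_right)
  have int_msd: "integrable \<mu> (\<lambda>x. (norm (x - z))\<^sup>2 / 2)"
    by (rule P4_integrable_C2_star[OF \<mu>(1) half_sq_dist_C2_star(1)])
  have int_bump: "integrable \<mu> (bump z \<rho>)"
    by (rule P4_integrable_C2_star[OF \<mu>(1) bump_C2_star(1)[OF pos(2)]])
  have "c \<le> (LINT x|\<mu>. bump z \<rho> x)" using \<mu>(2) by (simp add: bump_mass_def)
  also have "\<dots> \<le> (LINT x|\<mu>. (\<rho> ^ 6 * exp (\<alpha> * (F z + \<gamma> / 2))) * w x)"
  proof (rule integral_mono[OF int_bump])
    fix x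
    show "bump z \<rho> x \<le> (\<rho> ^ 6 * exp (\<alpha> * (F z + \<gamma> / 2))) * w x"
    proof (cases "norm (x - z) \<le> \<rho>")
      case True
      have "0 \<le> \<alpha> * (F z + \<gamma> / 2 - F x)" using flat[OF True] pos by simp
      then have "1 \<le> exp (\<alpha> * (F z + \<gamma> / 2)) * w x"
        by (simp add: w_def algebra_simps flip: exp_add)
      then have "\<rho> ^ 6 * 1 \<le> \<rho> ^ 6 * (exp (\<alpha> * (F z + \<gamma> / 2)) * w x)"
        using pos by (intro mult_left_mono) auto
      then show ?thesis using bump_le[of z \<rho> x] by (simp add: mult.assoc)
    qed (use bump_eq_0[of \<rho> x z] w(1)[of x] pos in auto)
  qed (use int_w in simp)
  finally have W_ge: "c \<le> \<rho> ^ 6 * exp (\<alpha> * (F z + \<gamma> / 2)) * W" using int_w by (simp add: W_def)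
  then have "0 < \<rho> ^ 6 * exp (\<alpha> * (F z + \<gamma> / 2)) * W" using pos by linarith
  then have W: "0 < W" by (rule zero_less_mult_pos) (use pos in simp)
  have "norm (LINT x|\<mu>. w x *\<^sub>R (x - z)) \<le> (LINT x|\<mu>. norm (w x *\<^sub>R (x - z)))"
    by (rule integral_norm_bound)
  also have "\<dots> \<le> (LINT x|\<mu>. e * w x + exp (- (\<alpha> * (F z + \<gamma>))) * (1 / 2 + (norm (x - z))\<^sup>2 / 2))"
  proof (rule integral_mono)
    show "integrable \<mu> (\<lambda>x. norm (w x *\<^sub>R (x - z)))" by (rule integrable_norm[OF int_dev])
    show "integrable \<mu> (\<lambda>x. e * w x + exp (- (\<alpha> * (F z + \<gamma>))) * (1 / 2 + (norm (x - z))\<^sup>2 / 2))"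
      by (intro Bochner_Integration.integrable_add integrable_mult_right int_w int_msd integrable_const)
    fix x
    have am: "norm (x - z) \<le> 1 / 2 + (norm (x - z))\<^sup>2 / 2"
      using sum_squares_bound[of 1 "norm (x - z)"] by simp
    show "norm (w x *\<^sub>R (x - z))
        \<le> e * w x + exp (- (\<alpha> * (F z + \<gamma>))) * (1 / 2 + (norm (x - z))\<^sup>2 / 2)"
    proof (cases "e \<le> norm (x - z)")
      case True
      have "w x \<le> exp (- (\<alpha> * (F z + \<gamma>)))" using sep[OF True] pos by (simp add: w_def)
      then have "w x * norm (x - z) \<le> exp (- (\<alpha> * (F z + \<gamma>))) * (1 / 2 + (norm (x - z))\<^sup>2 / 2)"
        using am w(1)[of x] by (intro mult_mono) auto
      moreover have "0 \<le> e * w x" using pos w(1)[of x] by simp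
      ultimately show ?thesis unfolding norm_scaleR abs_of_nonneg[OF w(1)] by linarith
    next
      case False
      then have "norm (x - z) * w x \<le> e * w x" using w(1)[of x] by (intro mult_right_mono) auto
      then have "w x * norm (x - z) \<le> e * w x" by (simp only: mult.commute)
      moreover have "0 \<le> exp (- (\<alpha> * (F z + \<gamma>))) * (1 / 2 + (norm (x - z))\<^sup>2 / 2)" by simp
      ultimately show ?thesis unfolding norm_scaleR abs_of_nonneg[OF w(1)] by linarith
    qed
  qed
  also have "\<dots> = e * W + exp (- (\<alpha> * (F z + \<gamma>))) * (1 / 2 + half_msd z \<mu>)"
    using int_w int_msd by (simp add: W_def half_msd_eq_integral prob_space)
  also have "\<dots> \<le> e * W + exp (- (\<alpha> * (F z + \<gamma>))) * (1 / 2 + u)"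
    using \<mu>(3) by simp
  also have "\<dots> \<le> e * W + (exp (- (\<alpha> * \<gamma> / 2)) * ((1 / 2 + u) * \<rho> ^ 6 / c)) * W"
  proof -
    have "0 \<le> half_msd z \<mu>" by (simp add: half_msd_def)
    then have u: "0 \<le> 1 / 2 + u" using \<mu>(3) by linarith
    have "exp (- (\<alpha> * (F z + \<gamma>))) * (1 / 2 + u) * c
        \<le> exp (- (\<alpha> * (F z + \<gamma>))) * (1 / 2 + u) * (\<rho> ^ 6 * exp (\<alpha> * (F z + \<gamma> / 2)) * W)"
      using u by (intro mult_left_mono W_ge) auto
    also have "\<dots> = (exp (- (\<alpha> * (F z + \<gamma>))) * exp (\<alpha> * (F z + \<gamma> / 2))) * ((1 / 2 + u) * \<rho> ^ 6) * W"
      by (simp add: mult_ac)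
    also have "exp (- (\<alpha> * (F z + \<gamma>))) * exp (\<alpha> * (F z + \<gamma> / 2)) = exp (- (\<alpha> * \<gamma> / 2))"
      unfolding exp_add[symmetric] by (simp add: algebra_simps)
    finally show ?thesis using pos by (simp add: pos_le_divide_eq)
  qed
  finally have *: "norm (LINT x|\<mu>. w x *\<^sub>R (x - z))
      \<le> (e + exp (- (\<alpha> * \<gamma> / 2)) * ((1 / 2 + u) * \<rho> ^ 6 / c)) * W" by (simp add: distrib_right)
  have "(LINT x|\<mu>. w x *\<^sub>R (x - z)) = (LINT x|\<mu>. w x *\<^sub>R x) - W *\<^sub>R z"
    using int_w int_wx by (simp add: scaleR_diff_right W_def)
  moreover have "consensus_point \<alpha> F \<mu> = (LINT x|\<mu>. w x *\<^sub>R x) /\<^sub>R W"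
    by (simp add: consensus_point_def w_def W_def)
  ultimately have "consensus_point \<alpha> F \<mu> - z = (LINT x|\<mu>. w x *\<^sub>R (x - z)) /\<^sub>R W"
    using W by (simp add: scaleR_diff_right)
  then have "norm (consensus_point \<alpha> F \<mu> - z) = norm (LINT x|\<mu>. w x *\<^sub>R (x - z)) / W"
    using W by (simp add: divide_inverse_commute)
  then show ?thesis using * unfolding pos_divide_le_eq[OF W, symmetric] by simp
qed

text \<open>Well-separation of the minimizer: almost minimal values force points close to \<open>z\<close>. This is the form
  in which the growth conditions enter the Laplace principle.\<close>
definition strict_minimizer :: "('a::real_normed_vector \<Rightarrow> real) \<Rightarrow> 'a \<Rightarrow> bool" where
  "strict_minimizer F z \<longleftrightarrow>
     (\<forall>x. F z \<le> F x) \<and> (\<forall>e>0. \<exists>\<gamma>>0. \<forall>x. e \<le> norm (x - z) \<longrightarrow> F z + \<gamma> \<le> F x)"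

lemma exp_neg_mult_le:
  fixes k A \<eta> \<alpha> :: real
  assumes "0 < k" "0 < \<eta>" "\<bar>A\<bar> / (k * \<eta>) < \<alpha>"
  shows "exp (- (\<alpha> * k)) * A \<le> \<eta>"
proof -
  have "0 \<le> \<bar>A\<bar> / (k * \<eta>)" using assms by simp
  then have "0 < \<alpha>" using assms(3) by linarith
  have "\<bar>A\<bar> \<le> \<eta> * (\<alpha> * k)" using assms by (simp add: pos_divide_less_eq mult_ac)
  also have "\<alpha> * k \<le> exp (\<alpha> * k)"
    using exp_ge_add_one_self[of "\<alpha> * k"] by linarith
  finally have "A \<le> \<eta> * exp (\<alpha> * k)" using assms(2) by simp
  then show ?thesis by (simp add: exp_minus field_simps)
qed

text \<open>The order of the quantifiers is the point: the radius depends on \<open>F\<close>, \<open>z\<close> and \<open>\<eta>\<close> only and may be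
  shrunk further, and the threshold for \<open>\<alpha>\<close> is uniform over all measures with mass at least \<open>c\<close> near \<open>z\<close> and
  second moment at most \<open>u\<close>.\<close>
lemma laplace_principle:
  fixes z :: "'a::euclidean_space"
  assumes F: "continuous_on UNIV F" and z: "strict_minimizer F z" and "0 < \<eta>"
  obtains \<rho>\<^sub>0 where "0 < \<rho>\<^sub>0"
    and "\<And>\<rho> c u. 0 < \<rho> \<Longrightarrow> \<rho> \<le> \<rho>\<^sub>0 \<Longrightarrow> 0 < c \<Longrightarrow> \<exists>\<alpha>\<^sub>0. \<forall>\<alpha>>\<alpha>\<^sub>0. \<forall>\<mu>\<in>P4. 0 < \<alpha> \<longrightarrow>
           c \<le> bump_mass z \<rho> \<mu> \<longrightarrow> half_msd z \<mu> \<le> u \<longrightarrow> norm (consensus_point \<alpha> F \<mu> - z) \<le> \<eta>"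
proof -
  have min: "F z \<le> F x" for x using z by (simp add: strict_minimizer_def)
  obtain \<gamma> where \<gamma>: "0 < \<gamma>" "\<And>x. \<eta> / 2 \<le> norm (x - z) \<Longrightarrow> F z + \<gamma> \<le> F x"
    using z \<open>0 < \<eta>\<close> unfolding strict_minimizer_def by (meson half_gt_zero)
  have "isCont F z" using F by (simp add: continuous_on_eq_continuous_at)
  then obtain s where s: "0 < s" "\<And>x. dist x z < s \<Longrightarrow> dist (F x) (F z) < \<gamma> / 2"
    using \<gamma>(1) unfolding continuous_at_eps_delta by (meson half_gt_zero)
  have flat: "F x \<le> F z + \<gamma> / 2" if "norm (x - z) \<le> s / 2" for x
    using s(2)[of x] that s(1) unfolding dist_norm real_norm_def by linarith
  show ?thesis
  proof (rule that[of "s / 2"])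
    show "0 < s / 2" using s(1) by simp
    fix \<rho> c u :: real assume \<rho>: "0 < \<rho>" "\<rho> \<le> s / 2" and "0 < c"
    define A where "A = (1 / 2 + u) * \<rho> ^ 6 / c"
    show "\<exists>\<alpha>\<^sub>0. \<forall>\<alpha>>\<alpha>\<^sub>0. \<forall>\<mu>\<in>P4. 0 < \<alpha> \<longrightarrow>
           c \<le> bump_mass z \<rho> \<mu> \<longrightarrow> half_msd z \<mu> \<le> u \<longrightarrow> norm (consensus_point \<alpha> F \<mu> - z) \<le> \<eta>"
    proof (intro exI[of _ "\<bar>A\<bar> / (\<gamma> / 2 * (\<eta> / 2))"] allI ballI impI)
      fix \<alpha> \<mu>
      assume \<alpha>: "\<bar>A\<bar> / (\<gamma> / 2 * (\<eta> / 2)) < \<alpha>" "0 < \<alpha>"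
        and \<mu>: "\<mu> \<in> P4" "c \<le> bump_mass z \<rho> \<mu>" "half_msd z \<mu> \<le> u"
      have "exp (- (\<alpha> * (\<gamma> / 2))) * A \<le> \<eta> / 2"
        using \<gamma>(1) \<open>0 < \<eta>\<close> by (intro exp_neg_mult_le[OF _ _ \<alpha>(1)]) auto
      moreover have "norm (consensus_point \<alpha> F \<mu> - z) \<le> \<eta> / 2 + exp (- (\<alpha> * \<gamma> / 2)) * A"
        unfolding A_def using \<open>0 < \<eta>\<close> \<rho> \<open>0 < c\<close> \<alpha>(2) \<mu> flat
        by (intro consensus_point_minus_le[OF F min \<gamma>(2)]) auto
      ultimately show "norm (consensus_point \<alpha> F \<mu> - z) \<le> \<eta>" by simp
    qed
  qed
qed

lemma A2_A3_strict_minimizer: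
  assumes "A2_A3 j r \<beta>"
  shows "strict_minimizer (penalized j r \<beta>) (argmin_penalized j r \<beta>)"
proof -
  define F where "F = penalized j r \<beta>"
  define z where "z = argmin_penalized j r \<beta>"
  obtain p C R where p: "p \<ge> 2" "C > 0" "R > 0" and near: "growth_near F z p C R" and "gap_away F z R"
    and "is_arg_min F (\<lambda>_. True) z"
    using assms unfolding A2_A3_def F_def z_def by blast
  then obtain G where G: "G > 0" "\<And>x. (norm (x - z))\<^sup>2 \<ge> R \<Longrightarrow> F x - (INF y. F y) \<ge> G"
    unfolding gap_away_def by blast
  have min: "F z \<le> F x" for x
    using \<open>is_arg_min F (\<lambda>_. True) z\<close> by (auto simp: is_arg_min_def not_less)
  then have inf: "(INF y. F y) = F z" by (intro cInf_eq_minimum) auto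
  have "\<exists>\<gamma>>0. \<forall>x. e \<le> norm (x - z) \<longrightarrow> F z + \<gamma> \<le> F x" if "0 < e" for e
  proof (intro exI[of _ "min (C * e powr p) G"] conjI allI impI)
    show "0 < min (C * e powr p) G" using p G(1) that by simp
    fix x assume x: "e \<le> norm (x - z)"
    show "F z + min (C * e powr p) G \<le> F x"
    proof (cases "(norm (x - z))\<^sup>2 \<le> R")
      case True
      have "C * e powr p \<le> C * norm (x - z) powr p"
        using x that p by (intro mult_left_mono powr_mono2) auto
      also have "\<dots> \<le> F x - F z" using near True unfolding growth_near_def inf by blast
      finally show ?thesis by simp
    next
      case False
      then show ?thesis using G(2)[of x] unfolding inf by auto
    qed
  qed
  then show ?thesis using min by (simp add: strict_minimizer_def F_def z_def)
qed

text \<open>The first point at which \<open>g\<close> fails to be positive would contradict the induction step.\<close>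
lemma continuous_pos_induct:
  fixes g :: "real \<Rightarrow> real"
  assumes "continuous_on {a..b} g" and "t \<in> {a..b}"
    and step: "\<And>t. t \<in> {a..b} \<Longrightarrow> (\<And>s. s \<in> {a..<t} \<Longrightarrow> 0 < g s) \<Longrightarrow> 0 < g t"
  shows "0 < g t"
proof (rule ccontr)
  assume "\<not> 0 < g t"
  define S where "S = {s \<in> {a..b}. g s \<le> 0}"
  have "closed S" unfolding S_def
    by (rule continuous_on_closed_Collect_le[OF assms(1) continuous_on_const]) simp
  moreover have "bounded S" by (rule bounded_subset[of "{a..b}"]) (auto simp: S_def)
  ultimately have "compact S" by (simp add: compact_eq_bounded_closed)
  moreover have "S \<noteq> {}" using assms(2) \<open>\<not> 0 < g t\<close> by (auto simp: S_def)
  ultimately obtain m where m: "m \<in> S" "\<And>s. s \<in> S \<Longrightarrow> m \<le> s"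
    using compact_attains_inf[of S] by metis
  have "0 < g s" if "s \<in> {a..<m}" for s
  proof (rule ccontr)
    assume "\<not> 0 < g s"
    then have "s \<in> S" using that m(1) by (simp add: S_def)
    then show False using m(2)[of s] that by simp
  qed
  moreover have "m \<in> {a..b}" using m(1) by (simp add: S_def)
  ultimately have "0 < g m" by (intro step[of m])
  then show False using m(1) by (simp add: S_def)
qed

lemma leak_rate_nonneg: "0 \<le> leak_rate lam \<sigma> d \<rho> B"
  by (simp add: leak_rate_def)

lemma drift_cost_nonneg: "0 < decay_rate lam \<sigma> d \<Longrightarrow> 0 \<le> drift_cost lam \<sigma> d"
  by (simp add: drift_cost_def)

lemma half_msd_nonneg: "0 \<le> half_msd z \<mu>"
  by (simp add: half_msd_def)

lemma bump_mass_nonneg: "0 \<le> bump_mass z \<rho> \<mu>"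
  by (simp add: bump_mass_def bump_nonneg)

text \<open>Bootstrap over one time step. The mass near \<open>z\<close> and the second moment are continuous in time, so
  continuous induction can be run on them and no continuity of the consensus point is required. As
  long as both are in the range of the Laplace principle, the differential inequalities bound them by
  their values at time \<open>a\<close> up to a controlled loss, which the last two hypotheses place strictly inside
  that range.\<close>
lemma consensus_point_stays_near:
  fixes f :: "real \<Rightarrow> 'a::euclidean_space measure"
  assumes FP: "FP_solution lam \<sigma> \<alpha> F a b \<mu> f" and t: "t \<in> {a..b}"
    and par: "0 \<le> lam" "0 < \<sigma>" "0 < decay_rate lam \<sigma> DIM('a)" "0 < \<rho>" "\<eta> \<le> B"
    and laplace: "\<And>\<nu>. \<nu> \<in> P4 \<Longrightarrow> c \<le> bump_mass z \<rho> \<nu> \<Longrightarrow> half_msd z \<nu> \<le> u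
          \<Longrightarrow> norm (consensus_point \<alpha> F \<nu> - z) \<le> \<eta>"
    and mass: "c < bump_mass z \<rho> (f a) * exp (- leak_rate lam \<sigma> DIM('a) \<rho> B * (b - a))"
    and msd: "half_msd z (f a) + drift_cost lam \<sigma> DIM('a) * \<eta>\<^sup>2 * (b - a) < u"
  shows "norm (consensus_point \<alpha> F (f t) - z) \<le> \<eta>"
proof -
  define g where "g = (\<lambda>s. min (bump_mass z \<rho> (f s) - c) (u - half_msd z (f s)))"
  have near: "norm (consensus_point \<alpha> F (f s) - z) \<le> \<eta>" if "s \<in> {a..b}" "0 < g s" for s
    using that FP_solution_P4[OF FP that(1)] by (intro laplace) (auto simp: g_def)
  have "0 < g t"
  proof (rule continuous_pos_induct[OF _ t])
    show "continuous_on {a..b} g"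
      unfolding g_def bump_mass_def half_msd_eq_integral
      by (intro continuous_intros FP_solution_continuous_on[OF FP]
          bump_C2_star(1)[OF par(4)] half_sq_dist_C2_star(1))
  next
    fix s assume s: "s \<in> {a..b}" and before: "\<And>s'. s' \<in> {a..<s} \<Longrightarrow> 0 < g s'"
    have near': "norm (consensus_point \<alpha> F (f s') - z) \<le> \<eta>" if "s' \<in> {a<..<s}" for s'
      using that s by (intro near before) auto
    have "leak_rate lam \<sigma> DIM('a) \<rho> B * (s - a) \<le> leak_rate lam \<sigma> DIM('a) \<rho> B * (b - a)"
      using s by (intro mult_left_mono leak_rate_nonneg) auto
    then have "bump_mass z \<rho> (f a) * exp (- leak_rate lam \<sigma> DIM('a) \<rho> B * (b - a))
        \<le> bump_mass z \<rho> (f a) * exp (- leak_rate lam \<sigma> DIM('a) \<rho> B * (s - a))"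
      by (intro mult_left_mono bump_mass_nonneg) simp
    also have "\<dots> \<le> bump_mass z \<rho> (f s)"
      using near' par(5) by (intro FP_solution_bump_mass_ge[OF FP s par(1,2,4)]) force
    finally have "c < bump_mass z \<rho> (f s)" using mass by simp
    moreover have "half_msd z (f s) \<le> half_msd z (f a) + drift_cost lam \<sigma> DIM('a) * \<eta>\<^sup>2 * (s - a)"
    proof (rule FP_solution_half_msd_le[OF FP s par(1,3)])
      fix s' assume "s' \<in> {a<..<s}"
      from near'[OF this] have "(norm (consensus_point \<alpha> F (f s') - z))\<^sup>2 \<le> \<eta>\<^sup>2"
        by (intro power_mono) auto
      then have "drift_cost lam \<sigma> DIM('a) * (norm (consensus_point \<alpha> F (f s') - z))\<^sup>2
          \<le> drift_cost lam \<sigma> DIM('a) * \<eta>\<^sup>2"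
        by (intro mult_left_mono drift_cost_nonneg par(3))
      moreover have "0 \<le> decay_rate lam \<sigma> DIM('a) * half_msd z (f s')"
        using par(3) half_msd_nonneg by (intro mult_nonneg_nonneg) auto
      ultimately show "- decay_rate lam \<sigma> DIM('a) * half_msd z (f s')
        + drift_cost lam \<sigma> DIM('a) * (norm (consensus_point \<alpha> F (f s') - z))\<^sup>2
        \<le> drift_cost lam \<sigma> DIM('a) * \<eta>\<^sup>2" by simp
    qed
    moreover have "drift_cost lam \<sigma> DIM('a) * \<eta>\<^sup>2 * (s - a) \<le> drift_cost lam \<sigma> DIM('a) * \<eta>\<^sup>2 * (b - a)"
      using s drift_cost_nonneg[OF par(3)] by (intro mult_left_mono) auto
    ultimately show "0 < g s" using msd by (simp add: g_def)
  qed
  then show ?thesis by (rule near[OF t])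
qed

lemma bump_mass_pos:
  assumes \<mu>: "\<mu> \<in> P4" and z: "z \<in> supp \<mu>" and "0 < \<rho>"
  shows "0 < bump_mass z \<rho> \<mu>"
proof -
  have ball: "0 < emeasure \<mu> (ball z \<rho>)" using z \<open>0 < \<rho>\<close> by (simp add: supp_def)
  have int: "integrable \<mu> (bump z \<rho>)"
    by (rule P4_integrable_C2_star[OF \<mu> bump_C2_star(1)[OF \<open>0 < \<rho>\<close>]])
  have "bump_mass z \<rho> \<mu> \<noteq> 0"
  proof
    assume "bump_mass z \<rho> \<mu> = 0"
    then have "AE x in \<mu>. bump z \<rho> x = 0"
      using integral_nonneg_eq_0_iff_AE[OF int] by (simp add: bump_mass_def bump_nonneg)
    moreover have "x \<notin> ball z \<rho>" if "bump z \<rho> x = 0" for x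
      using bump_pos[of x z \<rho>] that by (auto simp: dist_norm norm_minus_commute)
    ultimately have "AE x in \<mu>. x \<notin> ball z \<rho>" by (rule eventually_mono)
    moreover have "ball z \<rho> \<in> sets \<mu>" using P4_sets[OF \<mu>] by simp
    ultimately have "emeasure \<mu> (ball z \<rho>) = 0"
      using AE_iff_null_sets[of "ball z \<rho>" \<mu>] by (simp add: null_sets_def)
    then show False using ball by simp
  qed
  then show ?thesis using bump_mass_nonneg[of z \<rho> \<mu>] by linarith
qed

text \<open>Moments are tracked around \<open>xstar\<close>, but the Laplace principle uses the moment around the
  current minimizer.\<close>
lemma half_msd_le_shift:
  assumes \<mu>: "\<mu> \<in> P4"
  shows "half_msd z \<mu> \<le> 2 * half_msd y \<mu> + (norm (y - z))\<^sup>2"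
proof -
  interpret prob_space \<mu> by (rule P4_prob_space[OF \<mu>])
  note int = P4_integrable_C2_star[OF \<mu> half_sq_dist_C2_star(1)]
  have "half_msd z \<mu> \<le> (LINT x|\<mu>. 2 * ((norm (x - y))\<^sup>2 / 2) + (norm (y - z))\<^sup>2)"
    unfolding half_msd_eq_integral
  proof (rule integral_mono[OF int])
    show "integrable \<mu> (\<lambda>x. 2 * ((norm (x - y))\<^sup>2 / 2) + (norm (y - z))\<^sup>2)"
      by (intro Bochner_Integration.integrable_add integrable_mult_right int integrable_const)
    fix x
    have "norm (x - z) \<le> norm (x - y) + norm (y - z)" using norm_triangle_ineq[of "x - y" "y - z"] by simp
    then have "(norm (x - z))\<^sup>2 \<le> (norm (x - y) + norm (y - z))\<^sup>2" by (intro power_mono) auto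
    also have "\<dots> \<le> 2 * (norm (x - y))\<^sup>2 + 2 * (norm (y - z))\<^sup>2"
      using sum_squares_bound[of "norm (x - y)" "norm (y - z)"] by (simp add: power2_sum)
    finally show "(norm (x - z))\<^sup>2 / 2 \<le> 2 * ((norm (x - y))\<^sup>2 / 2) + (norm (y - z))\<^sup>2" by simp
  qed
  also have "\<dots> = 2 * half_msd y \<mu> + (norm (y - z))\<^sup>2"
    using integrable_mult_right[OF int[of y], of 2] by (simp add: half_msd_def prob_space)
  finally show ?thesis .
qed

text \<open>This turns mass retained near an infeasible point into a failing feasibility test.\<close>
lemma integral_ge_bump_mass:
  fixes r :: "'a::euclidean_space \<Rightarrow> real"
  assumes \<mu>: "\<mu> \<in> P4" and int: "integrable \<mu> r" and "0 < \<rho>"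
    and r: "\<And>x. 0 \<le> r x" "\<And>x. norm (x - z) \<le> \<rho> \<Longrightarrow> h \<le> r x" "0 \<le> h"
  shows "h / \<rho> ^ 6 * bump_mass z \<rho> \<mu> \<le> (LINT x|\<mu>. r x)"
proof -
  have int_bump: "integrable \<mu> (bump z \<rho>)"
    by (rule P4_integrable_C2_star[OF \<mu> bump_C2_star(1)[OF \<open>0 < \<rho>\<close>]])
  have "h / \<rho> ^ 6 * bump_mass z \<rho> \<mu> = (LINT x|\<mu>. h / \<rho> ^ 6 * bump z \<rho> x)"
    by (simp add: bump_mass_def)
  also have "\<dots> \<le> (LINT x|\<mu>. r x)"
  proof (rule integral_mono[OF _ int])
    fix x
    show "h / \<rho> ^ 6 * bump z \<rho> x \<le> r x"
    proof (cases "norm (x - z) \<le> \<rho>")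
      case True
      have "h / \<rho> ^ 6 * bump z \<rho> x \<le> h / \<rho> ^ 6 * \<rho> ^ 6"
        using r(3) \<open>0 < \<rho>\<close> by (intro mult_left_mono bump_le) auto
      then show ?thesis using r(2)[OF True] \<open>0 < \<rho>\<close> by simp
    qed (use bump_eq_0[of \<rho> x z] r(1)[of x] \<open>0 < \<rho>\<close> in auto)
  qed (use int_bump in simp)
  finally show ?thesis .
qed

section \<open>The penalty iteration\<close>

text \<open>The data of the constrained problem and of the algorithm that are fixed before the accuracy and
  the thresholds are chosen.\<close>
locale penalty_problem =
  fixes j r :: "'a::euclidean_space \<Rightarrow> real" and M :: "'a set" and xstar :: 'a and f0 :: "'a measure"
    and \<beta>bar lam \<sigma> \<beta>0 \<eta>\<theta> \<eta>\<beta> dt :: real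
  assumes j_cont: "continuous_on UNIV j"
    and r_feasible: "x \<in> M \<Longrightarrow> r x = 0"
    and r_infeasible: "x \<notin> M \<Longrightarrow> 0 < r x"
    and exact: "\<beta>bar \<le> \<beta> \<Longrightarrow> is_arg_min (penalized j r \<beta>) (\<lambda>_. True) xstar"
    and inexact: "0 \<le> \<beta> \<Longrightarrow> \<beta> < \<beta>bar \<Longrightarrow>
                    (INF x. ereal (penalized j r \<beta> x)) < (INF x\<in>M. ereal (j x))"
    and r_dist: "\<exists>y\<in>M. r x = norm (x - y) \<and> (\<forall>z\<in>M. norm (x - y) \<le> norm (x - z))"
    and lam: "0 < lam" and \<sigma>: "0 < \<sigma>" and contractive: "2 * lam > real DIM('a) * \<sigma>\<^sup>2"
    and \<beta>0: "0 < \<beta>0" and \<eta>\<theta>: "1 < \<eta>\<theta>" and \<eta>\<beta>: "1 < \<eta>\<beta>" and dt: "0 < dt"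
    and f0: "f0 \<in> P4"
begin

lemma r_nonneg: "0 \<le> r x"
  using r_feasible[of x] r_infeasible[of x] by (cases "x \<in> M") auto

lemma r_lipschitz: "\<bar>r x - r y\<bar> \<le> norm (x - y)"
proof -
  have "r x \<le> r y + norm (x - y)" for x y
  proof -
    obtain p where p: "p \<in> M" "r y = norm (y - p)" using r_dist[of y] by blast
    obtain q where "r x = norm (x - q)" "\<forall>z\<in>M. norm (x - q) \<le> norm (x - z)" using r_dist[of x] by blast
    then have "r x \<le> norm (x - p)" using p(1) by simp
    also have "\<dots> \<le> norm (x - y) + norm (y - p)" using norm_triangle_ineq[of "x - y" "y - p"] by simp
    finally show ?thesis using p(2) by simp
  qed
  from this[of x y] this[of y x] show ?thesis by (simp add: norm_minus_commute)
qed

lemma r_continuous: "continuous_on UNIV r"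
  unfolding continuous_on_iff dist_real_def dist_norm
  using r_lipschitz by (meson le_less_trans)

lemma penalized_continuous: "continuous_on UNIV (penalized j r \<beta>)"
  unfolding penalized_def[abs_def] by (intro continuous_intros j_cont r_continuous)

lemma r_integrable:
  assumes "\<mu> \<in> P4"
  shows "integrable \<mu> r"
proof (rule P4_integrable[OF assms r_continuous])
  fix x
  have "\<bar>r x\<bar> \<le> \<bar>r 0\<bar> + norm x" using r_lipschitz[of x 0] by simp
  also have "\<dots> \<le> \<bar>r 0\<bar> * (1 + norm x)\<^sup>2 + (1 + norm x)\<^sup>2"
    using mult_left_mono[of 1 "(1 + norm x)\<^sup>2" "\<bar>r 0\<bar>"]
    by (intro add_mono) (simp_all add: power2_sum)
  finally show "norm (r x) \<le> (\<bar>r 0\<bar> + 1) * (1 + norm x)\<^sup>2" by (simp add: distrib_right)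
qed

lemma argmin_eq_xstar:
  assumes "A2_A3 j r \<beta>" "\<beta>bar \<le> \<beta>"
  shows "argmin_penalized j r \<beta> = xstar"
proof (rule ccontr)
  assume "argmin_penalized j r \<beta> \<noteq> xstar"
  then have "0 < norm (xstar - argmin_penalized j r \<beta>)" by auto
  then obtain \<gamma> where "0 < \<gamma>"
      "penalized j r \<beta> (argmin_penalized j r \<beta>) + \<gamma> \<le> penalized j r \<beta> xstar"
    using A2_A3_strict_minimizer[OF assms(1)] unfolding strict_minimizer_def by blast
  moreover have "penalized j r \<beta> xstar \<le> penalized j r \<beta> (argmin_penalized j r \<beta>)"
    using exact[OF assms(2)] by (auto simp: is_arg_min_def not_less)
  ultimately show False by linarith
qed

text \<open>A feasible minimizer would have the value \<open>j z\<close>, which is no smaller than the constrained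
  infimum, against the strict inequality of the two infima below \<open>\<beta>bar\<close>.\<close>
lemma argmin_infeasible:
  assumes "A2_A3 j r \<beta>" "0 \<le> \<beta>" "\<beta> < \<beta>bar"
  shows "0 < r (argmin_penalized j r \<beta>)"
proof (rule ccontr)
  define z where "z = argmin_penalized j r \<beta>"
  assume "\<not> 0 < r (argmin_penalized j r \<beta>)"
  then have "z \<in> M" "r z = 0" using r_infeasible[of z] r_nonneg[of z] by (auto simp: z_def)
  then have "(INF x\<in>M. ereal (j x)) \<le> ereal (penalized j r \<beta> z)"
    by (auto simp: penalized_def intro: INF_lower2)
  also have "\<dots> \<le> (INF x. ereal (penalized j r \<beta> x))"
    using A2_A3_strict_minimizer[OF assms(1)] unfolding strict_minimizer_def z_def
    by (intro INF_greatest) simp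
  finally show False using inexact[OF assms(2,3)] by simp
qed

text \<open>Level \<open>i\<close> is the penalty parameter after \<open>i\<close> failed feasibility tests, and \<open>switch\<close> is the number
  of failures after which the penalization is exact. Levels that the run never reaches need not have
  a minimizer at all, hence the notion of an admissible level.\<close>
definition level :: "nat \<Rightarrow> real" where "level i = \<beta>0 * \<eta>\<beta> ^ i"
definition target :: "nat \<Rightarrow> 'a" where "target i = argmin_penalized j r (level i)"
definition admissible :: "nat \<Rightarrow> bool" where
  "admissible i \<longleftrightarrow> A2_A3 j r (level i) \<and> target i \<in> supp f0"
definition switch :: nat where "switch = (LEAST i. \<beta>bar \<le> level i)"

lemma level_pos: "0 < level i"
  using \<beta>0 \<eta>\<beta> by (simp add: level_def)

lemma level_less: "i < switch \<Longrightarrow> level i < \<beta>bar"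
  unfolding switch_def using not_less_Least[of i "\<lambda>i. \<beta>bar \<le> level i"] by simp

lemma level_ge:
  assumes "switch \<le> i"
  shows "\<beta>bar \<le> level i"
proof -
  obtain n where "\<beta>bar / \<beta>0 < \<eta>\<beta> ^ n" using real_arch_pow[OF \<eta>\<beta>] by blast
  then have "\<beta>bar \<le> level n" using \<beta>0 by (simp add: level_def pos_divide_less_eq mult.commute)
  then have "\<beta>bar \<le> level switch" unfolding switch_def by (rule LeastI)
  also have "level switch \<le> level i"
    unfolding level_def using assms \<beta>0 \<eta>\<beta> by (intro mult_left_mono power_increasing) auto
  finally show ?thesis .
qed

lemma target_eq_xstar: "admissible i \<Longrightarrow> switch \<le> i \<Longrightarrow> target i = xstar"
  by (simp add: admissible_def target_def argmin_eq_xstar level_ge)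

lemma r_target_pos: "admissible i \<Longrightarrow> i < switch \<Longrightarrow> 0 < r (target i)"
  using level_pos[of i] by (simp add: admissible_def target_def argmin_infeasible level_less less_imp_le)

text \<open>The sum is finite and independent of the number of steps: from level \<open>switch\<close> on all targets
  coincide with \<open>xstar\<close>. Thus \<open>2 * spread + 1\<close> bounds the distance from a point within \<open>1\<close> of one
  target to any other target, and the mass near every target can be tracked at all times, also while
  another target is in force.\<close>
definition spread :: real where "spread = (\<Sum>i<switch. norm (target i - xstar))"

lemma spread_nonneg: "0 \<le> spread"
  by (simp add: spread_def sum_nonneg)

lemma target_near_xstar:
  assumes "admissible i"
  shows "norm (target i - xstar) \<le> spread"
proof (cases "i < switch")
  case True
  then show ?thesis unfolding spread_def
    by (intro member_le_sum[of i _ "\<lambda>i. norm (target i - xstar)"]) auto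
qed (use target_eq_xstar[OF assms] spread_nonneg in simp)

abbreviation "reach \<equiv> 2 * spread + 1"

lemma decay_pos: "0 < decay_rate lam \<sigma> DIM('a)"
  using contractive by (simp add: decay_rate_def)

lemma near_target_imp:
  assumes "admissible i" "norm (X - target i) \<le> \<eta>" "\<eta> \<le> 1"
  shows "norm (X - xstar) \<le> reach" and "admissible l \<Longrightarrow> norm (X - target l) \<le> reach"
proof -
  have *: "norm (X - xstar) \<le> spread + 1"
    using norm_triangle_ineq[of "X - target i" "target i - xstar"] target_near_xstar[OF assms(1)]
      assms(2,3) by simp
  then show "norm (X - xstar) \<le> reach" using spread_nonneg by simp
  show "norm (X - target l) \<le> reach" if "admissible l"
    using norm_triangle_ineq4[of "X - xstar" "target l - xstar"] target_near_xstar[OF that] * by simp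
qed

text \<open>The bump mass near target \<open>i\<close> that is guaranteed to remain at time \<open>t\<close>.\<close>
definition retained :: "nat \<Rightarrow> real \<Rightarrow> real \<Rightarrow> real" where
  "retained i \<rho> t = bump_mass (target i) \<rho> f0 * exp (- leak_rate lam \<sigma> DIM('a) \<rho> reach * t)"

lemma retained_pos: "admissible i \<Longrightarrow> 0 < \<rho> \<Longrightarrow> 0 < retained i \<rho> t"
  by (simp add: retained_def admissible_def bump_mass_pos[OF f0])

lemma retained_antimono: "s \<le> t \<Longrightarrow> retained i \<rho> t \<le> retained i \<rho> s"
  unfolding retained_def
  by (intro mult_left_mono bump_mass_nonneg) (simp add: mult_left_mono leak_rate_nonneg)

text \<open>The bound for \<open>V\<close> after \<open>k\<close> steps: linear growth up to step \<open>switch\<close>, linear decay afterwards.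
  The truncated subtraction switches the decay on.\<close>
definition bound :: "real \<Rightarrow> nat \<Rightarrow> real" where
  "bound \<epsilon> k = half_msd xstar f0 + drift_cost lam \<sigma> DIM('a) * reach\<^sup>2 * dt * real (min k switch)
     - decay_rate lam \<sigma> DIM('a) * \<epsilon> / 2 * dt * real (k - switch)"

text \<open>Before the switch the radius is also at most half of the distance from the target to the feasible
  set, so that \<open>r\<close>, which is \<open>1\<close>-Lipschitz, stays away from \<open>0\<close> on the bump. The mass required is
  one half of what is retained at the final time, to leave room for the strict inequality in the
  bootstrap.\<close>
lemma level_thresholds:
  assumes i: "admissible i" and "0 < \<eta>"
  obtains \<rho> \<alpha>\<^sub>0 where "0 < \<rho>"
    and "i < switch \<Longrightarrow> (\<forall>x. norm (x - target i) \<le> \<rho> \<longrightarrow> r (target i) / 2 \<le> r x)"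
    and "\<forall>\<alpha>>\<alpha>\<^sub>0. \<forall>\<mu>\<in>P4. 0 < \<alpha> \<longrightarrow> retained i \<rho> T / 2 \<le> bump_mass (target i) \<rho> \<mu> \<longrightarrow>
           half_msd (target i) \<mu> \<le> u \<longrightarrow>
           norm (consensus_point \<alpha> (penalized j r (level i)) \<mu> - target i) \<le> \<eta>"
proof -
  have "strict_minimizer (penalized j r (level i)) (target i)"
    using i A2_A3_strict_minimizer[of j r "level i"] by (simp add: admissible_def target_def)
  from laplace_principle[OF penalized_continuous this \<open>0 < \<eta>\<close>]
  obtain \<rho>\<^sub>0 where \<rho>\<^sub>0: "0 < \<rho>\<^sub>0"
    and lap: "\<And>\<rho> c u. 0 < \<rho> \<Longrightarrow> \<rho> \<le> \<rho>\<^sub>0 \<Longrightarrow> 0 < c \<Longrightarrow> \<exists>\<alpha>\<^sub>0. \<forall>\<alpha>>\<alpha>\<^sub>0. \<forall>\<mu>\<in>P4. 0 < \<alpha> \<longrightarrow>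
           c \<le> bump_mass (target i) \<rho> \<mu> \<longrightarrow> half_msd (target i) \<mu> \<le> u \<longrightarrow>
           norm (consensus_point \<alpha> (penalized j r (level i)) \<mu> - target i) \<le> \<eta>"
    by blast
  define \<rho> where "\<rho> = (if i < switch then min \<rho>\<^sub>0 (r (target i) / 2) else \<rho>\<^sub>0)"
  have \<rho>: "0 < \<rho>" "\<rho> \<le> \<rho>\<^sub>0" using \<rho>\<^sub>0 r_target_pos[OF i] by (auto simp: \<rho>_def)
  have c: "0 < retained i \<rho> T / 2" using retained_pos[OF i \<rho>(1)] by simp
  have "r (target i) / 2 \<le> r x" if "i < switch" "norm (x - target i) \<le> \<rho>" for x
    using r_lipschitz[of x "target i"] that by (auto simp: \<rho>_def)
  then show ?thesis using that \<rho>(1) lap[OF \<rho> c] by blast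
qed

end

text \<open>A run that misses the accuracy \<open>\<epsilon>\<close> although \<open>\<theta>0\<close> and \<open>\<alpha>\<close> are past the thresholds for its
  first \<open>N\<close> steps. It exists only if the bound for \<open>V\<close> is positive after \<open>N\<close> steps, which a suitable
  choice of \<open>N\<close> excludes. Here \<open>\<eta>\<close> is the precision of the consensus point, small enough for the drift
  cost \<open>D * \<eta>^2\<close> to use up at most half of the dissipation \<open>\<kappa> * \<epsilon>\<close>, and \<open>u\<close> bounds the second moments
  around all targets during the first \<open>N\<close> steps.\<close>
locale stalled_run = penalty_problem +
  fixes \<epsilon> \<eta> \<alpha> \<theta>0 u :: real and N K :: nat and \<rho> :: "nat \<Rightarrow> real"
    and f :: "real \<Rightarrow> 'a measure" and \<beta> \<theta> :: "nat \<Rightarrow> real"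
  assumes \<epsilon>: "0 < \<epsilon>" "\<epsilon> < half_msd xstar f0"
    and \<eta>: "0 < \<eta>" "\<eta> \<le> 1" 
      "drift_cost lam \<sigma> DIM('a) * \<eta>\<^sup>2 \<le> decay_rate lam \<sigma> DIM('a) * \<epsilon> / 2"
    and u: "u = 2 * (half_msd xstar f0 + drift_cost lam \<sigma> DIM('a) * reach\<^sup>2 * dt * real switch)
      + spread\<^sup>2 + drift_cost lam \<sigma> DIM('a) * \<eta>\<^sup>2 * dt + 1"
    and N: "N \<le> K" and \<theta>0: "0 < \<theta>0"
    and \<rho>: "admissible i \<Longrightarrow> i \<le> N \<Longrightarrow> 0 < \<rho> i"
    and r_near: "admissible i \<Longrightarrow> i \<le> N \<Longrightarrow> i < switch \<Longrightarrow> norm (x - target i) \<le> \<rho> i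
      \<Longrightarrow> r (target i) / 2 \<le> r x"
    and laplace: "admissible i \<Longrightarrow> i \<le> N \<Longrightarrow> \<mu> \<in> P4
      \<Longrightarrow> retained i (\<rho> i) (real N * dt) / 2 \<le> bump_mass (target i) (\<rho> i) \<mu>
      \<Longrightarrow> half_msd (target i) \<mu> \<le> u
      \<Longrightarrow> norm (consensus_point \<alpha> (penalized j r (level i)) \<mu> - target i) \<le> \<eta>"
    and tolerance: "admissible i \<Longrightarrow> i \<le> N \<Longrightarrow> i < switch
      \<Longrightarrow> 1 / sqrt (\<theta>0 / \<eta>\<theta> ^ i) < r (target i) / 2 / \<rho> i ^ 6 * retained i (\<rho> i) (real N * dt)"
    and run: "penalized_CBO j r lam \<sigma> \<alpha> \<beta>0 \<theta>0 \<eta>\<theta> \<eta>\<beta> dt K f0 f \<beta> \<theta>"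
    and growth: "k \<in> {1..K} \<Longrightarrow> A2_A3 j r (\<beta> k)"
    and support: "k \<in> {1..K} \<Longrightarrow> \<beta> k < \<beta>bar \<Longrightarrow> argmin_penalized j r (\<beta> k) \<in> supp f0"
      "xstar \<in> supp f0"
    and stalled: "t \<in> {0..real K * dt} \<Longrightarrow> half_msd xstar (f t) \<noteq> \<epsilon>"
begin

text \<open>The last clause describes the parameters of the next step. Up to the switch every test has
  failed, so the level is the step number and \<open>\<theta>\<close> has been divided by \<open>\<eta>\<theta>\<close> each time: it starts at
  \<open>\<theta>0\<close>, so the cap \<open>\<theta>0\<close> is never active. After the switch only the lower bound on the level
  matters.\<close>
definition invariant :: "nat \<Rightarrow> bool" where
  "invariant k \<longleftrightarrow>
     \<epsilon> < half_msd xstar (f (real k * dt)) \<and>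
     half_msd xstar (f (real k * dt)) \<le> bound \<epsilon> k \<and>
     (\<forall>i\<le>N. admissible i \<longrightarrow>
        retained i (\<rho> i) (real k * dt) \<le> bump_mass (target i) (\<rho> i) (f (real k * dt))) \<and>
     (\<exists>i\<le>k. \<beta> (k + 1) = level i \<and>
        (k \<le> switch \<longrightarrow> i = k \<and> \<theta>0 / \<eta>\<theta> ^ k \<le> \<theta> (k + 1) \<and> \<theta> (k + 1) \<le> \<theta>0) \<and>
        (switch \<le> k \<longrightarrow> switch \<le> i))"

lemma invariant_0: "invariant 0"
proof -
  have "f 0 = f0" "\<beta> 1 = level 0" "\<theta> 1 = \<theta>0"
    using run by (auto simp: penalized_CBO_def level_def)
  then show ?thesis using \<epsilon> by (auto simp: invariant_def bound_def retained_def)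
qed

lemma invariant_Suc:
  assumes inv: "invariant k" and k: "k < N"
  shows "invariant (Suc k)"
proof -
  define a where "a = real k * dt"
  define b where "b = real (Suc k) * dt"
  have ba: "b - a = dt" "a \<le> b" "0 \<le> a" using dt by (auto simp: a_def b_def algebra_simps)
  have kK: "Suc k \<in> {1..K}" using k N by simp
  have "b \<le> real K * dt" unfolding b_def using dt kK by (intro mult_right_mono) auto
  have bN: "b \<le> real N * dt" unfolding b_def using dt k by (intro mult_right_mono) auto
  obtain i where i: "i \<le> k" "\<beta> (Suc k) = level i" and early: "k \<le> switch \<Longrightarrow>
      i = k \<and> \<theta>0 / \<eta>\<theta> ^ k \<le> \<theta> (Suc k) \<and> \<theta> (Suc k) \<le> \<theta>0" and late: "switch \<le> k \<Longrightarrow> switch \<le> i"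
    and V_a: "\<epsilon> < half_msd xstar (f a)" "half_msd xstar (f a) \<le> bound \<epsilon> k"
    and mass_a: "\<And>i. i \<le> N \<Longrightarrow> admissible i \<Longrightarrow>
      retained i (\<rho> i) a \<le> bump_mass (target i) (\<rho> i) (f a)"
    using inv unfolding invariant_def a_def by auto
  have iN: "i \<le> N" using i(1) k by simp
  have adm: "admissible i"
  proof (cases "level i < \<beta>bar")
    case True
    then show ?thesis using growth[OF kK] support(1)[OF kK] i(2) by (simp add: admissible_def target_def)
  next
    case False
    then show ?thesis
      using growth[OF kK] support(2) i(2) argmin_eq_xstar by (simp add: admissible_def target_def)
  qed
  have "FP_solution lam \<sigma> \<alpha> (penalized j r (\<beta> (Suc k))) (real (Suc k - 1) * dt) (real (Suc k) * dt)
        (f (real (Suc k - 1) * dt)) f \<and>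
      (if (LINT x|f (real (Suc k) * dt). r x) \<le> 1 / sqrt (\<theta> (Suc k))
       then \<theta> (Suc k + 1) = \<eta>\<theta> * \<theta> (Suc k) \<and> \<beta> (Suc k + 1) = \<beta> (Suc k)
       else \<theta> (Suc k + 1) = min (\<theta> (Suc k) / \<eta>\<theta>) \<theta>0 \<and> \<beta> (Suc k + 1) = \<eta>\<beta> * \<beta> (Suc k))"
    using run kK unfolding penalized_CBO_def by blast
  then have FP: "FP_solution lam \<sigma> \<alpha> (penalized j r (level i)) a b (f a) f"
    and update: "if (LINT x|f b. r x) \<le> 1 / sqrt (\<theta> (Suc k))
         then \<theta> (Suc (Suc k)) = \<eta>\<theta> * \<theta> (Suc k) \<and> \<beta> (Suc (Suc k)) = level i
         else \<theta> (Suc (Suc k)) = min (\<theta> (Suc k) / \<eta>\<theta>) \<theta>0 \<and> \<beta> (Suc (Suc k)) = \<eta>\<beta> * level i"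
    unfolding i(2) a_def b_def Suc_eq_plus1[symmetric] by simp_all
  have P4: "f t \<in> P4" if "t \<in> {a..b}" for t using FP_solution_P4[OF FP that] .
  \<comment> \<open>The bootstrap applies, because the invariant keeps mass near the current target.\<close>
  have near: "norm (consensus_point \<alpha> (penalized j r (level i)) (f t) - target i) \<le> \<eta>"
    if t: "t \<in> {a..b}" for t
  proof (rule consensus_point_stays_near[OF FP t _ \<sigma> decay_pos \<rho>[OF adm iN]])
    show "0 \<le> lam" using lam by simp
    show "\<eta> \<le> reach" using \<eta>(2) spread_nonneg by simp
    show "norm (consensus_point \<alpha> (penalized j r (level i)) \<nu> - target i) \<le> \<eta>"
      if "\<nu> \<in> P4" "retained i (\<rho> i) (real N * dt) / 2 \<le> bump_mass (target i) (\<rho> i) \<nu>"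
        "half_msd (target i) \<nu> \<le> u" for \<nu> using laplace[OF adm iN that] .
    have "retained i (\<rho> i) (real N * dt) / 2 < retained i (\<rho> i) (real N * dt)"
      using retained_pos[OF adm \<rho>[OF adm iN]] by simp
    also have "\<dots> \<le> retained i (\<rho> i) b" by (rule retained_antimono[OF bN])
    also have "\<dots> = retained i (\<rho> i) a * exp (- leak_rate lam \<sigma> DIM('a) (\<rho> i) reach * (b - a))"
      unfolding retained_def mult.assoc exp_add[symmetric] by (simp add: algebra_simps)
    also have "\<dots> \<le> bump_mass (target i) (\<rho> i) (f a)
        * exp (- leak_rate lam \<sigma> DIM('a) (\<rho> i) reach * (b - a))"
      by (intro mult_right_mono mass_a iN adm) simp
    finally show "retained i (\<rho> i) (real N * dt) / 2 < \<dots>" .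
    have "half_msd (target i) (f a) \<le> 2 * half_msd xstar (f a) + (norm (xstar - target i))\<^sup>2"
      using ba by (intro half_msd_le_shift P4) auto
    also have "\<dots> \<le> 2 * bound \<epsilon> k + spread\<^sup>2"
      using target_near_xstar[OF adm] V_a(2)
      by (intro add_mono power_mono) (auto simp: norm_minus_commute)
    also have "bound \<epsilon> k \<le> half_msd xstar f0 + drift_cost lam \<sigma> DIM('a) * reach\<^sup>2 * dt * real switch"
    proof -
      have "drift_cost lam \<sigma> DIM('a) * reach\<^sup>2 * dt * real (min k switch)
          \<le> drift_cost lam \<sigma> DIM('a) * reach\<^sup>2 * dt * real switch"
        using dt drift_cost_nonneg[OF decay_pos] by (intro mult_left_mono) auto
      moreover have "0 \<le> decay_rate lam \<sigma> DIM('a) * \<epsilon> / 2 * dt * real (k - switch)"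
        using decay_pos \<epsilon>(1) dt by simp
      ultimately show ?thesis unfolding bound_def by linarith
    qed
    finally show "half_msd (target i) (f a) + drift_cost lam \<sigma> DIM('a) * \<eta>\<^sup>2 * (b - a) < u"
      unfolding u ba(1) by simp
  qed
  \<comment> \<open>\<open>V\<close> starts the step above \<open>\<epsilon>\<close> and is continuous on it.\<close>
  have V_b: "\<epsilon> < half_msd xstar (f t)" if t: "t \<in> {a..b}" for t
  proof (rule ccontr)
    assume "\<not> \<epsilon> < half_msd xstar (f t)"
    moreover have "continuous_on {a..t} (\<lambda>t. half_msd xstar (f t))"
      using continuous_on_subset[OF FP_solution_continuous_on[OF FP half_sq_dist_C2_star(1)]] t
      unfolding half_msd_eq_integral by auto
    ultimately obtain s where "a \<le> s" "s \<le> t" "half_msd xstar (f s) = \<epsilon>"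
      using IVT2'[of "\<lambda>t. half_msd xstar (f t)" t \<epsilon> a] V_a(1) t by auto
    then show False using stalled[of s] t ba(3) \<open>b \<le> real K * dt\<close> by auto
  qed
  have b_mem: "b \<in> {a..b}" using ba by simp
  have mass_b: "retained l (\<rho> l) b \<le> bump_mass (target l) (\<rho> l) (f b)"
    if l: "l \<le> N" "admissible l" for l
  proof -
    have "retained l (\<rho> l) b = retained l (\<rho> l) a * exp (- leak_rate lam \<sigma> DIM('a) (\<rho> l) reach * (b - a))"
      unfolding retained_def mult.assoc exp_add[symmetric] by (simp add: algebra_simps)
    also have "\<dots> \<le> bump_mass (target l) (\<rho> l) (f a)
        * exp (- leak_rate lam \<sigma> DIM('a) (\<rho> l) reach * (b - a))"
      by (intro mult_right_mono mass_a l) simp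
    also have "\<dots> \<le> bump_mass (target l) (\<rho> l) (f b)"
      using lam by (intro FP_solution_bump_mass_ge[OF FP b_mem _ \<sigma> \<rho>[OF l(2,1)]]
          near_target_imp(2)[OF adm near \<eta>(2) l(2)]) auto
    finally show ?thesis .
  qed
  have V_decay: "half_msd xstar (f b) \<le> bound \<epsilon> (Suc k)"
  proof (cases "k < switch")
    case True
    have "half_msd xstar (f b) \<le> half_msd xstar (f a) + drift_cost lam \<sigma> DIM('a) * reach\<^sup>2 * (b - a)"
    proof (rule FP_solution_half_msd_le[OF FP b_mem _ decay_pos])
      fix s assume "s \<in> {a<..<b}"
      then have "norm (consensus_point \<alpha> (penalized j r (level i)) (f s) - xstar) \<le> reach"
        by (intro near_target_imp(1)[OF adm near \<eta>(2)]) auto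
      then have "drift_cost lam \<sigma> DIM('a)
          * (norm (consensus_point \<alpha> (penalized j r (level i)) (f s) - xstar))\<^sup>2
          \<le> drift_cost lam \<sigma> DIM('a) * reach\<^sup>2"
        by (intro mult_left_mono power_mono drift_cost_nonneg decay_pos) auto
      moreover have "0 \<le> decay_rate lam \<sigma> DIM('a) * half_msd xstar (f s)"
        using decay_pos half_msd_nonneg by (intro mult_nonneg_nonneg) auto
      ultimately show "- decay_rate lam \<sigma> DIM('a) * half_msd xstar (f s)
          + drift_cost lam \<sigma> DIM('a)
            * (norm (consensus_point \<alpha> (penalized j r (level i)) (f s) - xstar))\<^sup>2
          \<le> drift_cost lam \<sigma> DIM('a) * reach\<^sup>2"
        by simp
    qed (use lam in simp)
    also have "\<dots> \<le> bound \<epsilon> k + drift_cost lam \<sigma> DIM('a) * reach\<^sup>2 * dt" using V_a(2) by (simp add: ba(1))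
    also have "\<dots> = bound \<epsilon> (Suc k)" using True by (simp add: bound_def algebra_simps min_def)
    finally show ?thesis .
  next
    case False
    then have z: "target i = xstar" using late by (intro target_eq_xstar adm) auto
    have "half_msd xstar (f b) \<le> half_msd xstar (f a) + (- (decay_rate lam \<sigma> DIM('a) * \<epsilon> / 2)) * (b - a)"
    proof (rule FP_solution_half_msd_le[OF FP b_mem _ decay_pos])
      fix s assume s: "s \<in> {a<..<b}"
      then have "norm (consensus_point \<alpha> (penalized j r (level i)) (f s) - xstar) \<le> \<eta>"
        using near[of s] z by auto
      then have "drift_cost lam \<sigma> DIM('a)
          * (norm (consensus_point \<alpha> (penalized j r (level i)) (f s) - xstar))\<^sup>2
          \<le> drift_cost lam \<sigma> DIM('a) * \<eta>\<^sup>2"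
        by (intro mult_left_mono power_mono drift_cost_nonneg decay_pos) auto
      moreover have "decay_rate lam \<sigma> DIM('a) * \<epsilon> \<le> decay_rate lam \<sigma> DIM('a) * half_msd xstar (f s)"
        using decay_pos V_b[of s] s by (intro mult_left_mono) auto
      ultimately show "- decay_rate lam \<sigma> DIM('a) * half_msd xstar (f s)
          + drift_cost lam \<sigma> DIM('a)
            * (norm (consensus_point \<alpha> (penalized j r (level i)) (f s) - xstar))\<^sup>2
          \<le> - (decay_rate lam \<sigma> DIM('a) * \<epsilon> / 2)"
        using \<eta>(3) by linarith
    qed (use lam in simp)
    also have "\<dots> \<le> bound \<epsilon> k - decay_rate lam \<sigma> DIM('a) * \<epsilon> / 2 * dt" using V_a(2) by (simp add: ba(1))
    also have "\<dots> = bound \<epsilon> (Suc k)" 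
    proof -
      have "min (Suc k) switch = min k switch" "Suc k - switch = Suc (k - switch)"
        using False by auto
      then show ?thesis by (simp add: bound_def distrib_left)
    qed
    finally show ?thesis .
  qed
  have level_Suc: "\<eta>\<beta> * level i = level (Suc i)" by (simp add: level_def)
  have "\<exists>l\<le>Suc k. \<beta> (Suc (Suc k)) = level l \<and>
      (Suc k \<le> switch \<longrightarrow> l = Suc k \<and> \<theta>0 / \<eta>\<theta> ^ Suc k \<le> \<theta> (Suc (Suc k)) \<and> \<theta> (Suc (Suc k)) \<le> \<theta>0) \<and>
      (switch \<le> Suc k \<longrightarrow> switch \<le> l)"
  proof (cases "k < switch")
    case True
    then have ik: "i = k" and \<theta>: "\<theta>0 / \<eta>\<theta> ^ k \<le> \<theta> (Suc k)" "\<theta> (Suc k) \<le> \<theta>0" using early by auto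
    have pos: "0 < \<theta>0 / \<eta>\<theta> ^ k" using \<theta>0 \<eta>\<theta> by simp
    have sw: "i < switch" using True ik by simp
    \<comment> \<open>The target is infeasible and has kept mass around it, so the feasibility test fails.\<close>
    have "1 / sqrt (\<theta> (Suc k)) \<le> 1 / sqrt (\<theta>0 / \<eta>\<theta> ^ i)"
      using \<theta>(1) pos ik by (intro divide_left_mono) auto
    also have "\<dots> < r (target i) / 2 / \<rho> i ^ 6 * retained i (\<rho> i) (real N * dt)"
      by (rule tolerance[OF adm iN sw])
    also have "\<dots> \<le> r (target i) / 2 / \<rho> i ^ 6 * bump_mass (target i) (\<rho> i) (f b)"
      using mass_b[OF iN adm] retained_antimono[OF bN, of i "\<rho> i"] r_nonneg[of "target i"] \<rho>[OF adm iN]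
      by (intro mult_left_mono) auto
    also have "\<dots> \<le> (LINT x|f b. r x)"
      using r_nonneg r_near[OF adm iN sw] \<rho>[OF adm iN]
      by (intro integral_ge_bump_mass P4 b_mem r_integrable) auto
    finally have "\<theta> (Suc (Suc k)) = min (\<theta> (Suc k) / \<eta>\<theta>) \<theta>0 \<and> \<beta> (Suc (Suc k)) = level (Suc k)"
      using update level_Suc ik by simp
    moreover have "\<theta>0 / \<eta>\<theta> ^ Suc k \<le> \<theta> (Suc k) / \<eta>\<theta>"
      using divide_right_mono[OF \<theta>(1), of \<eta>\<theta>] \<eta>\<theta> by (simp add: mult.commute)
    moreover have "\<theta>0 / \<eta>\<theta> ^ Suc k \<le> \<theta>0"
      using \<theta>0 \<eta>\<theta> divide_left_mono[of 1 "\<eta>\<theta> ^ Suc k" \<theta>0] one_le_power[of \<eta>\<theta> "Suc k"] by simp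
    ultimately show ?thesis by (intro exI[of _ "Suc k"]) auto
  next
    case False
    then have "switch \<le> i" using late by simp
    moreover have "\<beta> (Suc (Suc k)) = level i \<or> \<beta> (Suc (Suc k)) = level (Suc i)"
      using update level_Suc by (auto split: if_splits)
    ultimately show ?thesis using False i(1) by (metis Suc_le_mono le_SucI not_less_eq_eq not_less)
  qed
  then show ?thesis
    unfolding invariant_def b_def[symmetric] using V_b[OF b_mem] V_decay mass_b by simp
qed

lemma bound_pos: "0 < bound \<epsilon> N"
proof -
  have "invariant k" if "k \<le> N" for k
    using that by (induction k) (auto intro: invariant_0 invariant_Suc)
  from this[of N] show ?thesis using \<epsilon>(1) by (auto simp: invariant_def)
qed

end

context penalty_problem begin

lemma accuracy_reached:
  assumes \<epsilon>: "0 < \<epsilon>" "\<epsilon> < half_msd xstar f0"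
  shows "\<exists>(Kmin::nat) (\<theta>min::real) (\<alpha>min::real). \<forall>K \<theta>0 \<alpha> f \<beta> \<theta>.
     K > Kmin \<and> \<theta>0 > \<theta>min \<and> \<alpha> > \<alpha>min \<and> \<theta>0 > 0 \<and> \<alpha> > 0 \<and>
     penalized_CBO j r lam \<sigma> \<alpha> \<beta>0 \<theta>0 \<eta>\<theta> \<eta>\<beta> dt K f0 f \<beta> \<theta> \<and>
     (\<forall>k\<in>{1..K}. A2_A3 j r (\<beta> k)) \<and>
     {argmin_penalized j r (\<beta> k) | k. k \<in> {1..K} \<and> \<beta> k < \<beta>bar} \<union> {xstar} \<subseteq> supp f0
     \<longrightarrow> (\<exists>T\<in>{0..real K * dt}. half_msd xstar (f T) = \<epsilon>)"
proof -
  have cost: "0 \<le> drift_cost lam \<sigma> DIM('a)" by (rule drift_cost_nonneg[OF decay_pos])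
  \<comment> \<open>Since \<open>\<eta> \<le> 1\<close>, the linear choice bounds \<open>\<eta>^2\<close> as well.\<close>
  define \<eta> where "\<eta> = min 1 (decay_rate lam \<sigma> DIM('a) * \<epsilon> / (2 * (drift_cost lam \<sigma> DIM('a) + 1)))"
  have \<eta>: "0 < \<eta>" "\<eta> \<le> 1" using cost decay_pos \<epsilon>(1) by (auto simp: \<eta>_def)
  have "drift_cost lam \<sigma> DIM('a) * \<eta>\<^sup>2 \<le> (drift_cost lam \<sigma> DIM('a) + 1) * \<eta>"
    using \<eta> cost unfolding power2_eq_square mult.assoc[symmetric]
    by (intro mult_right_mono) (auto simp: mult_left_le add_increasing2)
  also have "\<dots> \<le> (drift_cost lam \<sigma> DIM('a) + 1)
      * (decay_rate lam \<sigma> DIM('a) * \<epsilon> / (2 * (drift_cost lam \<sigma> DIM('a) + 1)))"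
    using cost by (intro mult_left_mono) (auto simp: \<eta>_def)
  also have "\<dots> = decay_rate lam \<sigma> DIM('a) * \<epsilon> / 2" using cost by (simp add: field_simps)
  finally have small: "drift_cost lam \<sigma> DIM('a) * \<eta>\<^sup>2 \<le> decay_rate lam \<sigma> DIM('a) * \<epsilon> / 2" .
  \<comment> \<open>\<open>V\<close> is the largest value of the bound, attained at the switch; \<open>n\<close> further steps of decay make
    it negative.\<close>
  define V where "V = half_msd xstar f0 + drift_cost lam \<sigma> DIM('a) * reach\<^sup>2 * dt * real switch"
  define u where "u = 2 * V + spread\<^sup>2 + drift_cost lam \<sigma> DIM('a) * \<eta>\<^sup>2 * dt + 1"
  obtain n where n: "V / (decay_rate lam \<sigma> DIM('a) * \<epsilon> / 2 * dt) < real n"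
    using reals_Archimedean2 by blast
  define N where "N = switch + n"
  have "\<forall>i. \<exists>\<rho> \<alpha>\<^sub>0. admissible i \<longrightarrow> 0 < \<rho> \<and>
      (i < switch \<longrightarrow> (\<forall>x. norm (x - target i) \<le> \<rho> \<longrightarrow> r (target i) / 2 \<le> r x)) \<and>
      (\<forall>\<alpha>>\<alpha>\<^sub>0. \<forall>\<mu>\<in>P4. 0 < \<alpha> \<longrightarrow> retained i \<rho> (real N * dt) / 2 \<le> bump_mass (target i) \<rho> \<mu> \<longrightarrow>
           half_msd (target i) \<mu> \<le> u \<longrightarrow>
           norm (consensus_point \<alpha> (penalized j r (level i)) \<mu> - target i) \<le> \<eta>)"
    by (metis level_thresholds[OF _ \<eta>(1)])
  then obtain \<rho> \<alpha>\<^sub>0 where \<rho>: "\<And>i. admissible i \<Longrightarrow> 0 < \<rho> i"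
    and r_near: "\<And>i x. admissible i \<Longrightarrow> i < switch \<Longrightarrow> norm (x - target i) \<le> \<rho> i \<Longrightarrow> r (target i) / 2 \<le> r x"
    and laplace: "\<And>i \<alpha> \<mu>. admissible i \<Longrightarrow> \<alpha>\<^sub>0 i < \<alpha> \<Longrightarrow> 0 < \<alpha> \<Longrightarrow> \<mu> \<in> P4 \<Longrightarrow>
           retained i (\<rho> i) (real N * dt) / 2 \<le> bump_mass (target i) (\<rho> i) \<mu> \<Longrightarrow>
           half_msd (target i) \<mu> \<le> u \<Longrightarrow>
           norm (consensus_point \<alpha> (penalized j r (level i)) \<mu> - target i) \<le> \<eta>"
    by metis
  \<comment> \<open>\<open>\<delta> i\<close> bounds the average of \<open>r\<close> from below at a feasibility test of level \<open>i\<close>.\<close>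
  define \<delta> where "\<delta> = (\<lambda>i. r (target i) / 2 / \<rho> i ^ 6 * retained i (\<rho> i) (real N * dt))"
  define \<alpha>min where "\<alpha>min = Max (\<alpha>\<^sub>0 ` {..N})"
  define \<theta>min where "\<theta>min = Max ((\<lambda>i. \<eta>\<theta> ^ i / (\<delta> i)\<^sup>2) ` {..N})"
  show ?thesis
  proof (rule exI[of _ N], rule exI[of _ \<theta>min], rule exI[of _ \<alpha>min], intro allI impI, rule ccontr)
    fix K :: nat and \<theta>0 \<alpha> :: real and f and \<beta> \<theta> :: "nat \<Rightarrow> real"
    assume run: "K > N \<and> \<theta>0 > \<theta>min \<and> \<alpha> > \<alpha>min \<and> \<theta>0 > 0 \<and> \<alpha> > 0 \<and>
     penalized_CBO j r lam \<sigma> \<alpha> \<beta>0 \<theta>0 \<eta>\<theta> \<eta>\<beta> dt K f0 f \<beta> \<theta> \<and>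
     (\<forall>k\<in>{1..K}. A2_A3 j r (\<beta> k)) \<and>
     {argmin_penalized j r (\<beta> k) | k. k \<in> {1..K} \<and> \<beta> k < \<beta>bar} \<union> {xstar} \<subseteq> supp f0"
      and stalled: "\<not> (\<exists>T\<in>{0..real K * dt}. half_msd xstar (f T) = \<epsilon>)"
    have \<alpha>\<^sub>0: "\<alpha>\<^sub>0 i < \<alpha>" if "i \<le> N" for i
      using run that Max_ge[of "\<alpha>\<^sub>0 ` {..N}" "\<alpha>\<^sub>0 i"] by (auto simp: \<alpha>min_def)
    have tolerance: "1 / sqrt (\<theta>0 / \<eta>\<theta> ^ i) < \<delta> i" if i: "admissible i" "i \<le> N" "i < switch" for i
    proof -
      have \<delta>: "0 < \<delta> i" using r_target_pos[OF i(1,3)] \<rho>[OF i(1)] retained_pos[OF i(1) \<rho>[OF i(1)]]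
        by (simp add: \<delta>_def)
      have "\<eta>\<theta> ^ i / (\<delta> i)\<^sup>2 \<le> \<theta>min" unfolding \<theta>min_def using i(2) by (intro Max_ge) auto
      then have "\<eta>\<theta> ^ i / (\<delta> i)\<^sup>2 < \<theta>0" using run by simp
      then have "(1 / \<delta> i)\<^sup>2 < \<theta>0 / \<eta>\<theta> ^ i"
        using \<delta> \<eta>\<theta> by (simp add: power_divide field_simps)
      then have less: "1 / \<delta> i < sqrt (\<theta>0 / \<eta>\<theta> ^ i)" by (rule real_less_rsqrt)
      moreover have "0 < 1 / \<delta> i" using \<delta> by simp
      ultimately have "0 < sqrt (\<theta>0 / \<eta>\<theta> ^ i)" by linarith
      then show ?thesis
        using less \<delta> by (simp only: pos_divide_less_eq mult.commute)
    qed
    have "stalled_run j r M xstar f0 \<beta>bar lam \<sigma> \<beta>0 \<eta>\<theta> \<eta>\<beta> dt \<epsilon> \<eta> \<alpha> \<theta>0 u N K \<rho> f \<beta> \<theta>"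
      by unfold_locales
        (use \<epsilon> \<eta> small run stalled \<rho> r_near \<alpha>\<^sub>0 tolerance in
          \<open>auto simp: u_def V_def \<delta>_def intro: laplace\<close>)
    then have pos: "0 < bound \<epsilon> N" by (rule stalled_run.bound_pos)
    have "V < decay_rate lam \<sigma> DIM('a) * \<epsilon> / 2 * dt * real n"
      using n decay_pos \<epsilon>(1) dt by (simp add: pos_divide_less_eq mult_ac)
    then have "bound \<epsilon> N < 0" by (simp add: bound_def N_def V_def)
    then show False using pos by simp
  qed
qed

end

theorem theorem3p1:
  fixes j r :: "'a::euclidean_space \<Rightarrow> real"
    and M :: "'a set" and xstar :: 'a and f0 :: "'a measure"
    and \<beta>bar lam \<sigma> \<beta>0 \<eta>\<theta> \<eta>\<beta> dt \<epsilon> :: real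
  assumes "continuous_on UNIV j"
    and "negligible (frontier M)"
    and "is_arg_min j (\<lambda>x. x \<in> M) xstar"
    and "\<forall>x\<in>M. r x = 0"
    and "\<forall>x. x \<notin> M \<longrightarrow> r x > 0"
    and "\<beta>bar \<ge> 0"
    and A1_1: "\<forall>\<beta>\<ge>\<beta>bar. is_arg_min (penalized j r \<beta>) (\<lambda>_. True) xstar"
    and A1_2: "\<forall>\<beta>. 0 \<le> \<beta> \<and> \<beta> < \<beta>bar \<longrightarrow>
                 (INF x. ereal (penalized j r \<beta> x)) < (INF x\<in>M. ereal (j x))"
    and A1_3: "\<forall>x. \<exists>y\<in>M. r x = norm (x - y) \<and> (\<forall>z\<in>M. norm (x - y) \<le> norm (x - z))"
    and "lam > 0" and "\<sigma> > 0" and "2 * lam > real DIM('a) * \<sigma>\<^sup>2"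
    and "\<beta>0 > 0" and "\<eta>\<theta> > 1" and "\<eta>\<beta> > 1" and "dt > 0"
    and "f0 \<in> P4"
    and "0 < \<epsilon>" and "\<epsilon> < half_msd xstar f0"
  shows "\<exists>(Kmin::nat) (\<theta>min::real) (\<alpha>min::real).
           \<forall>(K::nat) (\<theta>0::real) (\<alpha>::real) (f :: real \<Rightarrow> 'a measure)
              (\<beta> :: nat \<Rightarrow> real) (\<theta> :: nat \<Rightarrow> real).
             K > Kmin \<and> \<theta>0 > \<theta>min \<and> \<alpha> > \<alpha>min \<and> \<theta>0 > 0 \<and> \<alpha> > 0 \<and>
             penalized_CBO j r lam \<sigma> \<alpha> \<beta>0 \<theta>0 \<eta>\<theta> \<eta>\<beta> dt K f0 f \<beta> \<theta> \<and>
             (\<forall>k\<in>{1..K}. A2_A3 j r (\<beta> k)) \<and>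
             {argmin_penalized j r (\<beta> k) | k. k \<in> {1..K} \<and> \<beta> k < \<beta>bar} \<union> {xstar} \<subseteq> supp f0
             \<longrightarrow> (\<exists>T\<in>{0..real K * dt}. half_msd xstar (f T) = \<epsilon>)"
proof -
  interpret penalty_problem j r M xstar f0 \<beta>bar lam \<sigma> \<beta>0 \<eta>\<theta> \<eta>\<beta> dt
    by unfold_locales (use assms in auto)
  show ?thesis using assms by (intro accuracy_reached)
qed

end
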